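(* Let $u,\psi:\mathbb{C}\to\mathbb{C}$ be entire functions such that the weighted composition operator $W_{(u,\psi)}f=u\cdot(f\circ\psi)$ is bounded on the Fock space $\mathcal{F}_2$. Then $W_{(u,\psi)}$ is not supercyclic on $\mathcal{F}_2$.
   Context: The Fock space $\mathcal{F}_2$ is the Hilbert space of entire functions $f:\mathbb{C}\to\mathbb{C}$ that are square integrable with respect to the Gaussian measure $d\mu(z)=\frac{1}{\pi}e^{-|z|^2}\,dA(z)$, where $dA$ is Lebesgue measure on $\mathbb{C}$, with inner product $\langle f,g\rangle=\int_{\mathbb{C}}f\overline{g}\,d\mu$. For entire functions $u,\psi$, the weighted composition operator is $W_{(u,\psi)}f=u\cdot (f\circ\psi)$. It is bounded on $\mathcal{F}_2$ if it maps $\mathcal{F}_2$ into itself and is a bounded linear operator there. A bounded linear operator $T$ on a separable Banach space $\mathcal{H}$ is supercyclic if there is a vector $f\in\mathcal{H}$ such that the projective orbit $\{\lambda T^nf:\lambda\in\mathbb{C},\ n=0,1,2,\dots\}$ is dense in $\mathcal{H}$. *)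

theory Defs
  imports "HOL-Analysis.Analysis"
begin

definition gaussian_measure :: "complex measure" where
  "gaussian_measure = density lborel (\<lambda>z. ennreal (exp (- (cmod z)\<^sup>2) / pi))"

definition fock_space :: "(complex \<Rightarrow> complex) set" where
  "fock_space = {f. f holomorphic_on UNIV \<and> integrable gaussian_measure (\<lambda>z. (cmod (f z))\<^sup>2)}"

definition fock_inner :: "(complex \<Rightarrow> complex) \<Rightarrow> (complex \<Rightarrow> complex) \<Rightarrow> complex" where
  "fock_inner f g = integral\<^sup>L gaussian_measure (\<lambda>z. f z * cnj (g z))"

definition fock_norm :: "(complex \<Rightarrow> complex) \<Rightarrow> real" where
  "fock_norm f = sqrt (Re (fock_inner f f))"

definition fock_dist :: "(complex \<Rightarrow> complex) \<Rightarrow> (complex \<Rightarrow> complex) \<Rightarrow> real" where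
  "fock_dist f g = fock_norm (\<lambda>z. f z - g z)"

lemma sets_gaussian [measurable_cong, simp]: "sets gaussian_measure = sets borel"
  by (simp add: gaussian_measure_def)

lemma fock_norm_eq: "fock_norm f = sqrt (integral\<^sup>L gaussian_measure (\<lambda>z. (cmod (f z))\<^sup>2))"
proof -
  have "fock_inner f f = integral\<^sup>L gaussian_measure (\<lambda>z. complex_of_real ((cmod (f z))\<^sup>2))"
    unfolding fock_inner_def complex_norm_square ..
  then show ?thesis
    by (simp add: fock_norm_def del: of_real_power)
qed

lemma fock_norm_nonneg: "0 \<le> fock_norm f"
  by (simp add: fock_norm_eq)

lemma fock_norm_power2: "(fock_norm f)\<^sup>2 = integral\<^sup>L gaussian_measure (\<lambda>z. (cmod (f z))\<^sup>2)"
  by (simp add: fock_norm_eq)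

lemma measurable_holomorphic:
  assumes "f holomorphic_on UNIV"
  shows "f \<in> borel_measurable gaussian_measure"
  using borel_measurable_continuous_onI[OF holomorphic_on_imp_continuous_on[OF assms]]
  by simp

lemma fock_measurable: "f \<in> fock_space \<Longrightarrow> f \<in> borel_measurable gaussian_measure"
  using measurable_holomorphic by (auto simp: fock_space_def)

lemma cmod_add_power2_le:
  assumes "t > (0::real)"
  shows "(cmod (a + b))\<^sup>2 \<le> (1 + t) * (cmod a)\<^sup>2 + (1 + 1/t) * (cmod b)\<^sup>2"
proof -
  have "(cmod (a + b))\<^sup>2 \<le> (cmod a + cmod b)\<^sup>2"
    by (simp add: norm_triangle_ineq power_mono)
  also have "\<dots> \<le> (1 + t) * (cmod a)\<^sup>2 + (1 + 1/t) * (cmod b)\<^sup>2"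
  proof -
    have "0 \<le> (t * cmod a - cmod b)\<^sup>2 / t"
      using assms by simp
    also have "\<dots> = t * (cmod a)\<^sup>2 + (cmod b)\<^sup>2 / t - 2 * cmod a * cmod b"
      using assms by (simp add: field_simps power2_eq_square)
    finally show ?thesis by (simp add: power2_sum algebra_simps)
  qed
  finally show ?thesis .
qed

lemma fock_add:
  assumes "f \<in> fock_space" "g \<in> fock_space"
  shows "(\<lambda>z. f z + g z) \<in> fock_space"
proof -
  have [measurable]: "f \<in> borel_measurable gaussian_measure" "g \<in> borel_measurable gaussian_measure"
    using assms fock_measurable by auto
  have "integrable gaussian_measure (\<lambda>z. 2 * (cmod (f z))\<^sup>2 + 2 * (cmod (g z))\<^sup>2)"
    using assms by (auto simp: fock_space_def)
  then have "integrable gaussian_measure (\<lambda>z. (cmod (f z + g z))\<^sup>2)"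
    by (rule Bochner_Integration.integrable_bound)
       (use cmod_add_power2_le[of 1] in auto)
  then show ?thesis
    using assms by (auto simp: fock_space_def intro: holomorphic_on_add)
qed

lemma fock_scale:
  assumes "f \<in> fock_space"
  shows "(\<lambda>z. c * f z) \<in> fock_space"
  using assms by (auto simp: fock_space_def norm_mult power_mult_distrib intro!: holomorphic_intros)

lemma fock_diff:
  assumes "f \<in> fock_space" "g \<in> fock_space"
  shows "(\<lambda>z. f z - g z) \<in> fock_space"
  using fock_add[OF assms(1) fock_scale[OF assms(2), of "-1"]] by simp

lemma fock_norm_eq_0:
  assumes f: "f \<in> fock_space" and 0: "fock_norm f = 0"
  shows "f z = 0"
proof (rule ccontr)
  assume nz: "f z \<noteq> 0"
  have [measurable]: "f \<in> borel_measurable borel"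
    using fock_measurable[OF f] by simp
  have "AE x in gaussian_measure. (cmod (f x))\<^sup>2 = 0"
    using 0 f by (subst integral_nonneg_eq_0_iff_AE[symmetric]) (auto simp: fock_norm_eq fock_space_def)
  then have ae: "AE x in lborel. f x = 0"
    unfolding gaussian_measure_def by (subst (asm) AE_density) auto
  have "continuous_on UNIV f"
    using f holomorphic_on_imp_continuous_on by (auto simp: fock_space_def)
  then have "open {x. f x \<noteq> 0}"
    by (intro open_Collect_neq) auto
  then obtain e where e: "e > 0" "ball z e \<subseteq> {x. f x \<noteq> 0}"
    using openE[of "{x. f x \<noteq> 0}" z] nz by blast
  have "AE x in lborel. x \<notin> ball z e"
    using ae
  proof eventually_elim
    case (elim x)
    then show "x \<notin> ball z e" using e(2) by blast
  qed
  then have "ball z e \<in> null_sets lborel"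
    by (simp add: AE_iff_null_sets)
  then have "negligible (ball z e)"
    by (simp add: negligible_iff_null_sets null_sets_completionI)
  then show False
    using e open_not_negligible[of "ball z e"] by auto
qed

lemma fock_norm_triangle:
  assumes f: "f \<in> fock_space" and g: "g \<in> fock_space"
  shows "fock_norm (\<lambda>z. f z + g z) \<le> fock_norm f + fock_norm g"
proof (cases "fock_norm f = 0 \<or> fock_norm g = 0")
  case True
  then consider "\<And>z. f z = 0" | "\<And>z. g z = 0"
    using f g fock_norm_eq_0 by blast
  then show ?thesis
    by cases (auto simp: fock_norm_nonneg)
next
  case False
  let ?a = "fock_norm f" and ?b = "fock_norm g"
  have pos: "?a > 0" "?b > 0"
    using False fock_norm_nonneg[of f] fock_norm_nonneg[of g] by auto
  define t where "t = ?b / ?a"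
  have t: "t > 0" using pos by (simp add: t_def)
  have int: "integrable gaussian_measure (\<lambda>z. (cmod (f z))\<^sup>2)"
    "integrable gaussian_measure (\<lambda>z. (cmod (g z))\<^sup>2)"
    "integrable gaussian_measure (\<lambda>z. (cmod (f z + g z))\<^sup>2)"
    using f g fock_add[OF f g] by (auto simp: fock_space_def)
  have "(fock_norm (\<lambda>z. f z + g z))\<^sup>2
      \<le> integral\<^sup>L gaussian_measure (\<lambda>z. (1 + t) * (cmod (f z))\<^sup>2 + (1 + 1/t) * (cmod (g z))\<^sup>2)"
    unfolding fock_norm_power2 using int t
    by (intro integral_mono cmod_add_power2_le) auto
  also have "\<dots> = (1 + t) * ?a\<^sup>2 + (1 + 1/t) * ?b\<^sup>2"
    using int by (simp add: fock_norm_power2)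
  also have "\<dots> = (?a + ?b)\<^sup>2"
    using pos by (simp add: t_def field_simps power2_eq_square)
  finally show ?thesis
    using pos by (auto dest: power2_le_imp_le)
qed

interpretation Fock: Metric_space fock_space fock_dist
proof
  show "0 \<le> fock_dist f g" for f g
    by (simp add: fock_dist_def fock_norm_nonneg)
  show "fock_dist f g = fock_dist g f" for f g
    by (simp add: fock_dist_def fock_norm_eq norm_minus_commute)
  show "fock_dist f g = 0 \<longleftrightarrow> f = g" if "f \<in> fock_space" "g \<in> fock_space" for f g
  proof
    assume "fock_dist f g = 0"
    then have "f z - g z = 0" for z
      using fock_norm_eq_0[OF fock_diff[OF that]] by (simp add: fock_dist_def)
    then show "f = g" by (simp add: fun_eq_iff)
  qed (simp add: fock_dist_def fock_norm_eq)
  show "fock_dist f h \<le> fock_dist f g + fock_dist g h"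
    if "f \<in> fock_space" "g \<in> fock_space" "h \<in> fock_space" for f g h
    using fock_norm_triangle[OF fock_diff[OF that(1,2)] fock_diff[OF that(2,3)]]
    by (simp add: fock_dist_def)
qed

definition fock_bounded_operator ::
    "((complex \<Rightarrow> complex) \<Rightarrow> (complex \<Rightarrow> complex)) \<Rightarrow> bool" where
  "fock_bounded_operator T \<longleftrightarrow>
     (\<forall>f\<in>fock_space. T f \<in> fock_space) \<and>
     (\<forall>f\<in>fock_space. \<forall>g\<in>fock_space. T (\<lambda>z. f z + g z) = (\<lambda>z. T f z + T g z)) \<and>
     (\<forall>c. \<forall>f\<in>fock_space. T (\<lambda>z. c * f z) = (\<lambda>z. c * T f z)) \<and>
     (\<exists>C. \<forall>f\<in>fock_space. fock_norm (T f) \<le> C * fock_norm f)"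

definition weighted_composition ::
    "(complex \<Rightarrow> complex) \<Rightarrow> (complex \<Rightarrow> complex) \<Rightarrow> (complex \<Rightarrow> complex) \<Rightarrow> (complex \<Rightarrow> complex)" where
  "weighted_composition u \<psi> f = (\<lambda>z. u z * f (\<psi> z))"

definition projective_orbit ::
    "((complex \<Rightarrow> complex) \<Rightarrow> (complex \<Rightarrow> complex)) \<Rightarrow> (complex \<Rightarrow> complex) \<Rightarrow> (complex \<Rightarrow> complex) set" where
  "projective_orbit T f = {(\<lambda>z. c * (T ^^ n) f z) | c n. True}"

definition fock_supercyclic ::
    "((complex \<Rightarrow> complex) \<Rightarrow> (complex \<Rightarrow> complex)) \<Rightarrow> bool" where
  "fock_supercyclic T \<longleftrightarrow>
     (\<exists>f\<in>fock_space. Fock.mtopology closure_of projective_orbit T f = fock_space)"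

end

(*
  A vector f with dense projective orbit forces u to have no zero p: every iterate T^n f with n > 0
  vanishes at p.  Testing boundedness on the reproducing kernels gives
  |u(z)|^2 exp(|psi(z)|^2 - |z|^2) <= C, so u = e^h with Re h of quadratic growth; hence h = O(|z|^2) by
  Borel-Caratheodory, and psi(z) = a z + b with |a| <= 1.

  If psi has a fixed point p, then M g = g(p) and L g = g'(p) - kappa g(p), for a suitable kappa, are
  eigenvectors of the adjoint with eigenvalues u(p) and a u(p).  As |a| <= 1, the closed condition
  |L g| |M f| <= |L f| |M g| holds on the whole projective orbit of f, but not on the whole space.

  Otherwise psi(z) = z + b with b nonzero, and Liouville gives u(z) = k exp(-conj(b) z): T is a multiple
  of a Weyl isometry.  Normalised iterates tend to 0 pointwise, so an approximation of g with g(0) = 1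
  uses only finitely many exponents n.  Such g therefore lie on the countably many lines spanned by the
  T^n f, which is impossible since the functions 1 + t z lie on different lines.
*)
theory Submission
  imports Defs "HOL-Complex_Analysis.Complex_Analysis" "HOL-Probability.Distributions"
    "HOL-Real_Asymp.Real_Asymp"
begin

section \<open>Rotation invariance and the mean value property\<close>

text \<open>Orthogonal maps of \<open>real^2\<close> preserve Lebesgue measure. Reading the plane as
  \<open>real^2\<close> makes this available for rotations of \<open>complex\<close>; it suffices
  that boxes correspond to boxes with the same sides.\<close>

lemma lborel_complex_eq_distr:
  "(lborel :: complex measure) = distr lborel borel (\<lambda>v::real^2. Complex (v $ 1) (v $ 2))"
proof (rule lborel_eqI)
  let ?\<phi> = "\<lambda>v::real^2. Complex (v $ 1) (v $ 2)"
  fix l u :: complex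
  assume le: "\<And>b. b \<in> Basis \<Longrightarrow> l \<bullet> b \<le> u \<bullet> b"
  have [measurable]: "?\<phi> \<in> borel_measurable borel"
    by (intro borel_measurable_continuous_onI) (auto simp: Complex_eq intro!: continuous_intros)
  have "?\<phi> -` box l u = box (vector [Re l, Im l]) (vector [Re u, Im u])"
    by (auto simp: box_def Basis_complex_def Basis_vec_def forall_2 inner_axis)
  moreover have "Re l \<le> Re u" "Im l \<le> Im u"
    using le[of 1] le[of \<i>] by (auto simp: Basis_complex_def)
  ultimately show "emeasure (distr lborel borel ?\<phi>) (box l u) = (\<Prod>b\<in>Basis. (u - l) \<bullet> b)"
    by (subst emeasure_distr)
       (auto simp: emeasure_lborel_box_eq Basis_complex_def Basis_vec_def forall_2 inner_axis UNION_singleton_eq_range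
         UNIV_2 axis_eq_axis inner_diff_left)
qed simp

text \<open>In real coordinates, multiplication by a unimodular number is orthogonal, so it
  preserves the measure of each box.\<close>

lemma lborel_distr_rotate:
  assumes "cmod c = 1"
  shows "distr lborel borel (\<lambda>z. c * z) = lborel"
proof (rule lborel_eqI[symmetric])
  let ?\<phi> = "\<lambda>v::real^2. Complex (v $ 1) (v $ 2)"
  let ?\<theta> = "\<lambda>z. vector [Re z, Im z] :: real^2"
  \<comment> \<open>Multiplication by \<open>cnj c\<close> inverts multiplication by
    \<open>c\<close>. This turns the preimage of a box under the rotation into an image, the form in
    which orthogonal invariance applies.\<close>
  let ?R = "\<lambda>v. ?\<theta> (cnj c * ?\<phi> v)"
  fix l u :: complex
  assume le: "\<And>b. b \<in> Basis \<Longrightarrow> l \<bullet> b \<le> u \<bullet> b"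
  have [measurable]: "?\<phi> \<in> borel_measurable borel"
    by (intro borel_measurable_continuous_onI) (auto simp: Complex_eq intro!: continuous_intros)
  have inv1: "?\<phi> (?\<theta> z) = z" and inv2: "?\<theta> (?\<phi> v) = v" for z v
    by (auto simp: vec_eq_iff forall_2)
  have c1: "c * cnj c = 1" "cnj c * c = 1"
    using assms complex_norm_square[of c] by (auto simp: mult.commute)
  let ?B = "?\<phi> -` box l u"
  have Beq: "?B = box (?\<theta> l) (?\<theta> u)"
    by (auto simp: box_def Basis_complex_def Basis_vec_def forall_2 inner_axis)
  have "orthogonal_transformation ?R"
  proof (rule orthogonal_transformation[THEN iffD2], intro conjI allI)
    show "linear ?R"
      by (rule linearI) (auto simp: vec_eq_iff forall_2 algebra_simps)
    fix v
    have "norm (?R v) = cmod (cnj c * ?\<phi> v)"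
      by (simp add: norm_vec_def L2_set_def sum_2 cmod_def)
    also have "\<dots> = cmod (?\<phi> v)"
      using assms by (simp only: norm_mult complex_mod_cnj mult_1)
    also have "\<dots> = norm v"
      by (simp add: norm_vec_def L2_set_def sum_2 cmod_def)
    finally show "norm (?R v) = norm v" .
  qed
  then have R: "?R ` ?B \<in> lmeasurable" "measure lebesgue (?R ` ?B) = measure lebesgue ?B"
    unfolding Beq by (intro measurable_orthogonal_image measure_orthogonal_image; simp)+
  have img: "?R ` ?B = (\<lambda>v. c * ?\<phi> v) -` box l u"
  proof (intro set_eqI iffI)
    fix v assume v: "v \<in> (\<lambda>v. c * ?\<phi> v) -` box l u"
    have "?\<theta> (c * ?\<phi> v) \<in> ?B"
      using v by (simp only: vimage_eq inv1)
    moreover have "?R (?\<theta> (c * ?\<phi> v)) = v"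
      by (simp only: inv1 mult.assoc[symmetric] c1 mult_1 inv2)
    ultimately show "v \<in> ?R ` ?B"
      by (metis (no_types, lifting) imageI)
  next
    fix v assume "v \<in> ?R ` ?B"
    then obtain w where w: "w \<in> ?B" "v = ?R w" by (rule imageE)
    have "c * ?\<phi> (?R w) = ?\<phi> w"
      by (simp only: inv1 mult.assoc[symmetric] c1 mult_1)
    then show "v \<in> (\<lambda>v. c * ?\<phi> v) -` box l u"
      using w by (simp only: vimage_eq)
  qed
  have meas: "(\<lambda>v. c * ?\<phi> v) -` box l u \<in> sets borel"
    by (rule measurable_sets_borel[where M=borel]) auto
  have "emeasure (distr lborel borel (\<lambda>z. c * z)) (box l u) = emeasure lborel ((\<lambda>v. c * ?\<phi> v) -` box l u)"
    by (simp add: lborel_complex_eq_distr emeasure_distr distr_distr comp_def)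
  also have "\<dots> = emeasure lebesgue (?R ` ?B)"
    unfolding img using meas by simp
  also have "\<dots> = emeasure lebesgue ?B"
    using R by (simp add: emeasure_eq_measure2 Beq)
  also have "\<dots> = emeasure lborel (box l u)"
    by (subst lborel_complex_eq_distr) (simp add: emeasure_distr Beq)
  finally show "emeasure (distr lborel borel (\<lambda>z. c * z)) (box l u) = (\<Prod>b\<in>Basis. (u - l) \<bullet> b)"
    using le by simp
qed simp

lemma lborel_translate:
  fixes f :: "'a::euclidean_space \<Rightarrow> real"
  assumes [measurable]: "f \<in> borel_measurable borel"
  shows "integrable lborel (\<lambda>z. f (w + z)) \<longleftrightarrow> integrable lborel f"
    and "(LINT z|lborel. f (w + z)) = integral\<^sup>L lborel f"
proof -
  have eq: "lborel = distr lborel borel ((+) w)"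
    by (simp add: lborel_distr_plus)
  show "integrable lborel (\<lambda>z. f (w + z)) \<longleftrightarrow> integrable lborel f"
    by (subst (2) eq) (simp add: integrable_distr_eq)
  show "(LINT z|lborel. f (w + z)) = integral\<^sup>L lborel f"
    by (subst (2) eq) (simp add: integral_distr)
qed

section \<open>Mean values over the unit disc\<close>

text \<open>Choose a unimodular \<open>c\<close> with \<open>c ^ j = -1\<close>. Rotating by
  \<open>c\<close> changes the sign of the integrand but not the integral, so the integral is its
  own negative.\<close>

lemma integral_ball_power:
  assumes "j > 0"
  shows "(LINT z|lborel. indicator (ball 0 1) z *\<^sub>R (z::complex) ^ j) = 0"
proof -
  define c where "c = cis (pi / real j)"
  have c: "cmod c = 1" "c ^ j = -1"
    using assms by (auto simp: c_def Complex.DeMoivre)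
  have [measurable]: "(\<lambda>z. indicator (ball 0 1) z *\<^sub>R (z::complex) ^ j) \<in> borel_measurable borel"
    by (intro borel_measurable_scaleR borel_measurable_indicator) auto
  have "(LINT z|lborel. indicator (ball 0 1) z *\<^sub>R (z::complex) ^ j)
      = (LINT z|lborel. indicator (ball 0 1) (c * z) *\<^sub>R (c * z) ^ j)"
    by (subst lborel_distr_rotate[OF c(1), symmetric], subst integral_distr) auto
  also have "\<dots> = (LINT z|lborel. - (indicator (ball 0 1) z *\<^sub>R (z::complex) ^ j))"
    using c by (intro Bochner_Integration.integral_cong)
      (auto simp: indicator_def norm_mult power_mult_distrib)
  finally show ?thesis
    by simp
qed

text \<open>The mean value property over a disc: in the integrated Taylor series all terms of
  positive degree vanish by rotation, and only the constant term is left.\<close>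

lemma integral_ball_holomorphic:
  assumes "g holomorphic_on UNIV"
  shows "(LINT z|lborel. indicator (ball 0 1) z *\<^sub>R g z) = measure lborel (ball (0::complex) 1) *\<^sub>R g 0"
proof -
  define a where "a k = (deriv ^^ k) g 0 / fact k" for k
  define V where "V = measure lborel (ball (0::complex) 1)"
  let ?f = "\<lambda>k z. indicator (ball 0 1) z *\<^sub>R (a k * z ^ k) :: complex"
  have sums: "(\<lambda>k. a k * z ^ k) sums g z" for z
    using holomorphic_power_series[of g 0 "norm z + 1" z] assms holomorphic_on_subset
    by (auto simp: a_def)
  \<comment> \<open>Convergence at the point 2, outside the closed unit disc, gives absolute
    convergence at radius 1. This dominates the series on the whole ball and permits termwise
    integration.\<close>
  have sa: "summable (\<lambda>k. cmod (a k))"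
    using powser_insidea[OF sums_summable[OF sums[of 2]], of 1] by simp
  have fin: "integrable lborel (indicator (ball (0::complex) 1) :: _ \<Rightarrow> real)"
    using emeasure_lborel_ball_finite[of "0::complex" 1] by (intro integrable_real_indicator) auto
  have int: "integrable lborel (?f k)" for k
  proof (rule Bochner_Integration.integrable_bound)
    show "integrable lborel (\<lambda>z::complex. cmod (a k) * indicator (ball 0 1) z)"
      using fin by simp
    show "AE z in lborel. norm (?f k z) \<le> norm (cmod (a k) * indicator (ball 0 1) z)"
      by (auto simp: norm_mult norm_power power_le_one indicator_def intro!: mult_left_le)
    show "?f k \<in> borel_measurable lborel"
      by (intro borel_measurable_scaleR borel_measurable_indicator) auto
  qed
  have nle: "(LINT z|lborel. norm (?f k z)) \<le> cmod (a k) * V" for k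
  proof -
    have "(LINT z|lborel. norm (?f k z)) \<le> (LINT z|lborel. cmod (a k) * indicator (ball (0::complex) 1) z)"
      by (intro integral_mono integrable_norm int integrable_mult_right fin) (auto simp: norm_mult norm_power power_le_one indicator_def intro!: mult_left_le)
    then show ?thesis by (simp add: V_def)
  qed
  have "(\<lambda>k. integral\<^sup>L lborel (?f k)) sums (LINT z|lborel. (\<Sum>k. ?f k z))"
  proof (rule sums_integral)
    show "AE z in lborel. summable (\<lambda>k. norm (?f k z))"
    proof (rule AE_I2)
      fix z
      show "summable (\<lambda>k. norm (?f k z))"
        by (rule summable_comparison_test'[OF sa, of 0])
          (auto simp: norm_mult norm_power power_le_one indicator_def intro!: mult_left_le)
    qed
    show "summable (\<lambda>k. LINT z|lborel. norm (?f k z))"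
      by (rule summable_comparison_test'[OF summable_mult2[OF sa, of V], of 0])
        (use nle in \<open>auto simp del: norm_scaleR\<close>)
  qed (fact int)
  moreover have "(\<Sum>k. ?f k z) = indicator (ball 0 1) z *\<^sub>R g z" for z
    using sums_unique[OF sums[of z]] by (auto simp: indicator_def)
  moreover have "integral\<^sup>L lborel (?f k) = (if k = 0 then V *\<^sub>R g 0 else 0)" for k
  proof (cases "k = 0")
    case False
    have "integral\<^sup>L lborel (?f k) = (LINT z|lborel. a k * (indicator (ball 0 1) z *\<^sub>R z ^ k))"
      by simp
    also have "\<dots> = 0"
      using integral_ball_power[of k] False by (subst integral_mult_right_zero) simp
    finally show ?thesis using False by simp
  qed (use fin in \<open>simp add: a_def V_def\<close>)
  ultimately have "(\<lambda>k. if k = 0 then V *\<^sub>R g 0 else 0) sums (LINT z|lborel. indicator (ball 0 1) z *\<^sub>R g z)"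
    by simp
  then show ?thesis
    using sums_single[of 0 "\<lambda>_. V *\<^sub>R g 0"] sums_unique2 V_def by blast
qed

section \<open>Point evaluations on the Fock space\<close>

text \<open>The integrand of the squared norm over \<open>lborel\<close>, without the factor 1/pi.
  With the weight absorbed, a Weyl translation of \<open>f\<close> acts on it as a plain translation
  of the plane.\<close>

definition gauss_density :: "(complex \<Rightarrow> complex) \<Rightarrow> complex \<Rightarrow> real" where
  "gauss_density f z = (cmod (f z))\<^sup>2 * exp (- (cmod z)\<^sup>2)"

lemma gauss_density_nonneg: "0 \<le> gauss_density f z"
  by (simp add: gauss_density_def)

lemma gauss_density_measurable:
  "f holomorphic_on UNIV \<Longrightarrow> gauss_density f \<in> borel_measurable borel"
  unfolding gauss_density_def
  by (intro borel_measurable_continuous_onI continuous_intros holomorphic_on_imp_continuous_on)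

lemma fock_space_iff:
  "f \<in> fock_space \<longleftrightarrow> f holomorphic_on UNIV \<and> integrable lborel (gauss_density f)"
proof (cases "f holomorphic_on UNIV")
  case True
  have [measurable]: "f \<in> borel_measurable borel"
    using measurable_holomorphic[OF True] by simp
  have "integrable gaussian_measure (\<lambda>z. (cmod (f z))\<^sup>2)
      \<longleftrightarrow> integrable lborel (\<lambda>z. (1 / pi) * gauss_density f z)"
    unfolding gaussian_measure_def
    by (subst integrable_density) (auto simp: gauss_density_def mult_ac)
  then show ?thesis
    using True by (simp add: fock_space_def integrable_mult_right_iff del: times_divide_eq_left)
qed (simp add: fock_space_def)

lemma fock_norm_gauss_density:
  assumes "f holomorphic_on UNIV"
  shows "(fock_norm f)\<^sup>2 = (LINT z|lborel. gauss_density f z) / pi"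
proof -
  have [measurable]: "f \<in> borel_measurable borel"
    using measurable_holomorphic[OF assms] by simp
  have "(fock_norm f)\<^sup>2 = (LINT z|lborel. (1 / pi) * gauss_density f z)"
    unfolding fock_norm_power2 unfolding gaussian_measure_def
    by (subst integral_density) (auto simp: gauss_density_def mult_ac)
  then show ?thesis by simp
qed

text \<open>A local form of the point evaluation bound. Integrating only over the unit ball around
  \<open>w\<close> yields both continuity of evaluations and decay of the density at
  infinity.\<close>

lemma gauss_density_le_ball_integral:
  assumes f: "f \<in> fock_space"
  shows "measure lborel (ball (0::complex) 1) * gauss_density f w
    \<le> exp 1 * (LINT z|lborel. indicator (ball w 1) z * gauss_density f z)"
proof -
  define V where "V = measure lborel (ball (0::complex) 1)"
  \<comment> \<open>The exponential recentres the Gaussian weight at \<open>w\<close>, and the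
    square makes the modulus of \<open>g\<close> quadratic in \<open>f\<close>. On the unit ball,
    this modulus is the translated density up to the constant exp(|w|^2) and a factor of at most
    e.\<close>
  define g where "g z = (f (z + w) * exp (- cnj w * z))\<^sup>2" for z
  have hol: "f holomorphic_on UNIV" and int: "integrable lborel (gauss_density f)"
    using f by (auto simp: fock_space_iff)
  note [measurable] = gauss_density_measurable[OF hol]
  have holw: "(\<lambda>z. f (z + w)) holomorphic_on UNIV"
    by (rule holomorphic_on_compose_gen[where f="\<lambda>z. z + w" and g=f, unfolded o_def])
      (use hol in \<open>auto intro!: holomorphic_intros\<close>)
  have holg: "g holomorphic_on UNIV"
    unfolding g_def by (intro holomorphic_intros holw)
  have ng: "cmod (g z) = exp ((cmod w)\<^sup>2) * exp ((cmod z)\<^sup>2) * gauss_density f (z + w)" for z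
  proof -
    have "(cmod (z + w))\<^sup>2 = (cmod z)\<^sup>2 + (cmod w)\<^sup>2 + 2 * Re (cnj w * z)"
      unfolding cmod_power2 by (simp add: power2_eq_square algebra_simps)
    then show ?thesis
      by (simp add: g_def norm_power norm_mult power_mult_distrib gauss_density_def
        mult_exp_exp power2_eq_square[of "exp _"] algebra_simps)
  qed
  define \<phi> where "\<phi> z = indicator (ball w 1) z * gauss_density f z" for z
  have [measurable]: "\<phi> \<in> borel_measurable borel"
    unfolding \<phi>_def
    by (intro borel_measurable_times borel_measurable_indicator gauss_density_measurable hol) auto
  have int\<phi>: "integrable lborel \<phi>"
    by (rule Bochner_Integration.integrable_bound[OF int])
      (auto simp: \<phi>_def indicator_def gauss_density_nonneg)
  have shift: "integrable lborel (\<lambda>z. \<phi> (w + z))" "(LINT z|lborel. \<phi> (w + z)) = integral\<^sup>L lborel \<phi>"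
    using int\<phi> by (simp_all add: lborel_translate)
  have [measurable]: "g \<in> borel_measurable borel"
    using measurable_holomorphic[OF holg] by simp
  have le: "norm (indicator (ball 0 1) z *\<^sub>R g z) \<le> exp ((cmod w)\<^sup>2) * exp 1 * \<phi> (w + z)" for z
  proof (cases "z \<in> ball 0 1")
    case True
    then have "(cmod z)\<^sup>2 \<le> 1"
      by (simp add: power_le_one)
    then have "exp ((cmod z)\<^sup>2) \<le> exp (1::real)"
      by simp
    moreover have "w + z \<in> ball w 1"
      using True by (simp add: dist_norm)
    ultimately show ?thesis
      using True by (simp add: ng \<phi>_def add.commute gauss_density_nonneg mult_right_mono mult_left_mono)
  qed (simp add: \<phi>_def gauss_density_nonneg)
  have "V * (exp ((cmod w)\<^sup>2) * gauss_density f w) = norm (LINT z|lborel. indicator (ball 0 1) z *\<^sub>R g z)"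
    unfolding integral_ball_holomorphic[OF holg] by (simp add: ng V_def)
  also have "\<dots> \<le> (LINT z|lborel. exp ((cmod w)\<^sup>2) * exp 1 * \<phi> (w + z))"
  proof (rule Bochner_Integration.integral_norm_bound_integral)
    show dom: "integrable lborel (\<lambda>z. exp ((cmod w)\<^sup>2) * exp 1 * \<phi> (w + z))"
      by (intro integrable_mult_right shift)
    show "integrable lborel (\<lambda>z. indicator (ball 0 1) z *\<^sub>R g z)"
      by (rule Bochner_Integration.integrable_bound[OF dom])
        (auto simp del: norm_scaleR intro!: AE_I2 borel_measurable_scaleR borel_measurable_indicator order_trans[OF le abs_ge_self])
  qed (rule le)
  also have "\<dots> = exp ((cmod w)\<^sup>2) * (exp 1 * integral\<^sup>L lborel \<phi>)"
    by (simp add: shift)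
  finally show ?thesis
    by (simp add: V_def \<phi>_def[abs_def] mult.left_commute)
qed

lemma measure_unit_ball_pos: "0 < measure lborel (ball (0::complex) 1)"
  using content_ball_pos[of 1 "0::complex"] by simp

text \<open>Enlarge the local integral to the whole plane. The constant \<open>E\<close> serves all
  \<open>f\<close> and \<open>w\<close>, and the growth in \<open>w\<close> is that of the norm of
  the reproducing kernel.\<close>

lemma fock_eval_bound:
  obtains E where "E > 0"
    "\<And>f w. f \<in> fock_space \<Longrightarrow> cmod (f w) \<le> E * exp ((cmod w)\<^sup>2 / 2) * fock_norm f"
proof
  let ?V = "measure lborel (ball (0::complex) 1)"
  define E where "E = sqrt (exp 1 * pi / ?V)"
  have V: "?V > 0" by (rule measure_unit_ball_pos)
  show "E > 0" using V by (simp add: E_def)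
  fix f w assume f: "f \<in> fock_space"
  have hol: "f holomorphic_on UNIV" and int: "integrable lborel (gauss_density f)"
    using f by (auto simp: fock_space_iff)
  note [measurable] = gauss_density_measurable[OF hol]
  have "(LINT z|lborel. indicator (ball w 1) z * gauss_density f z) \<le> integral\<^sup>L lborel (gauss_density f)"
    by (intro integral_mono int Bochner_Integration.integrable_bound[OF int])
      (auto simp: indicator_def gauss_density_nonneg)
  then have "?V * gauss_density f w \<le> exp 1 * (pi * (fock_norm f)\<^sup>2)"
    using gauss_density_le_ball_integral[OF f, of w] by (simp add: fock_norm_gauss_density[OF hol] order_trans)
  then have "gauss_density f w \<le> (E * fock_norm f)\<^sup>2"
    using V by (simp add: E_def power_mult_distrib field_simps)
  then have "(cmod (f w))\<^sup>2 \<le> (E * fock_norm f)\<^sup>2 * exp ((cmod w)\<^sup>2)"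
    by (simp add: gauss_density_def exp_minus field_simps)
  also have "exp ((cmod w)\<^sup>2) = (exp ((cmod w)\<^sup>2 / 2))\<^sup>2"
    by (simp add: power2_eq_square mult_exp_exp flip: exp_add)
  finally have "(cmod (f w))\<^sup>2 \<le> (E * exp ((cmod w)\<^sup>2 / 2) * fock_norm f)\<^sup>2"
    by (simp add: power_mult_distrib mult_ac)
  then show "cmod (f w) \<le> E * exp ((cmod w)\<^sup>2 / 2) * fock_norm f"
    by (rule power2_le_imp_le) (use \<open>E > 0\<close> in \<open>simp add: fock_norm_nonneg\<close>)
qed

text \<open>The unit balls around the points n b eventually leave every given point, so by dominated
  convergence the local integrals that control the density tend to 0.\<close>

lemma gauss_density_tendsto_0:
  assumes f: "f \<in> fock_space" and b: "b \<noteq> 0"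
  shows "(\<lambda>n. gauss_density f (of_nat n * b)) \<longlonglongrightarrow> 0"
proof -
  let ?V = "measure lborel (ball (0::complex) 1)"
  have V: "?V > 0" by (rule measure_unit_ball_pos)
  have hol: "f holomorphic_on UNIV" and int: "integrable lborel (gauss_density f)"
    using f by (auto simp: fock_space_iff)
  note [measurable] = gauss_density_measurable[OF hol]
  let ?J = "\<lambda>n z. indicator (ball (of_nat n * b) 1) z * gauss_density f z"
  have "(\<lambda>n. integral\<^sup>L lborel (?J n)) \<longlonglongrightarrow> (LINT z|(lborel :: complex measure). 0)"
  proof (rule integral_dominated_convergence)
    show "AE z in lborel. (\<lambda>n. ?J n z) \<longlonglongrightarrow> 0"
    proof (rule AE_I2)
      fix z :: complex
      obtain N :: nat where N: "(cmod z + 1) / cmod b < real N"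
        using reals_Archimedean2 by blast
      have "z \<notin> ball (of_nat n * b) 1" if "n \<ge> N" for n
      proof -
        have "(cmod z + 1) / cmod b < real n" using N that by (meson of_nat_mono order_less_le_trans)
        then have "cmod z + 1 < cmod (of_nat n * b)"
          using b by (simp add: field_simps norm_mult)
        then show ?thesis
          using norm_triangle_ineq2[of "of_nat n * b" z] by (simp add: dist_norm)
      qed
      then have "\<forall>\<^sub>F n in sequentially. ?J n z = 0"
        by (intro eventually_sequentiallyI[of N]) simp
      then show "(\<lambda>n. ?J n z) \<longlonglongrightarrow> 0"
        by (rule tendsto_eventually)
    qed
  qed (use int in \<open>auto simp: indicator_def gauss_density_nonneg\<close>)
  then have lim: "(\<lambda>n. exp 1 / ?V * integral\<^sup>L lborel (?J n)) \<longlonglongrightarrow> 0"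
    by (simp add: tendsto_mult_right_zero)
  have le: "gauss_density f w \<le> exp 1 / ?V * (LINT z|lborel. indicator (ball w 1) z * gauss_density f z)" for w
    using gauss_density_le_ball_integral[OF f, of w] V
    by (simp only: times_divide_eq_left pos_le_divide_eq mult.commute)
  show ?thesis
  proof (rule tendsto_sandwich[OF _ _ tendsto_const lim])
    show "\<forall>\<^sub>F n in sequentially. gauss_density f (of_nat n * b) \<le> exp 1 / ?V * integral\<^sup>L lborel (?J n)"
      by (intro always_eventually allI le)
  qed (simp add: gauss_density_nonneg)
qed

section \<open>Gaussian integrals and membership in the Fock space\<close>

text \<open>The integrand factors over the real and imaginary coordinates into one-dimensional
  Gaussians, each a multiple of a normal density of variance 1/(2a).\<close>

lemma integrable_exp_neg_cmod_power2:
  assumes "a > 0"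
  shows "integrable lborel (\<lambda>z::complex. exp (- a * (cmod z)\<^sup>2))"
proof -
  have fin: "(\<integral>\<^sup>+x. ennreal (exp (- a * x\<^sup>2)) \<partial>lborel) < \<infinity>"
  proof -
    define \<sigma> where "\<sigma> = sqrt (1 / (2 * a))"
    have \<sigma>: "\<sigma> > 0" "2 * \<sigma>\<^sup>2 = 1 / a" using assms by (auto simp: \<sigma>_def)
    have "exp (- a * x\<^sup>2) = sqrt (2 * pi * \<sigma>\<^sup>2) * normal_density 0 \<sigma> x" for x
      using \<sigma> assms by (simp add: normal_density_def field_simps)
    then have "integrable lborel (\<lambda>x. exp (- a * x\<^sup>2))"
      using integrable_normal_density[OF \<sigma>(1), of 0] by simp
    then show ?thesis
      by (simp add: integrable_iff_bounded)
  qed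
  have eq: "exp (- a * (cmod z)\<^sup>2) = (\<Prod>b\<in>Basis. exp (- a * (z \<bullet> b)\<^sup>2))" for z
    by (simp add: Basis_complex_def cmod_power2 mult_exp_exp algebra_simps)
  have "(\<integral>\<^sup>+z. ennreal (exp (- a * (cmod z)\<^sup>2)) \<partial>(lborel :: complex measure))
      = (\<integral>\<^sup>+z. (\<Prod>b\<in>Basis. ennreal (exp (- a * (z \<bullet> b)\<^sup>2))) \<partial>(lborel :: complex measure))"
    unfolding eq by (simp add: prod_ennreal)
  also have "\<dots> = (\<Prod>b\<in>(Basis :: complex set). (\<integral>\<^sup>+x. ennreal (exp (- a * x\<^sup>2)) \<partial>lborel))"
    by (subst nn_integral_lborel_prod) auto
  also have "\<dots> < \<infinity>"
    using fin by (simp add: Basis_complex_def ennreal_mult_less_top)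
  finally show ?thesis
    by (intro integrableI_bounded) auto
qed

lemma fock_space_if_bounded_by_exp:
  assumes "f holomorphic_on UNIV" and "a < 1"
    and "\<And>z. (cmod (f z))\<^sup>2 \<le> C * exp (a * (cmod z)\<^sup>2)"
  shows "f \<in> fock_space"
  unfolding fock_space_iff
proof
  note [measurable] = gauss_density_measurable[OF assms(1)]
  show "integrable lborel (gauss_density f)"
  proof (rule Bochner_Integration.integrable_bound)
    show "integrable lborel (\<lambda>z::complex. C * exp (- (1 - a) * (cmod z)\<^sup>2))"
      by (intro integrable_mult_right integrable_exp_neg_cmod_power2) (use assms in auto)
    have "gauss_density f z \<le> C * exp (- (1 - a) * (cmod z)\<^sup>2)" for z
    proof -
      have "gauss_density f z \<le> C * exp (a * (cmod z)\<^sup>2) * exp (- (cmod z)\<^sup>2)"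
        unfolding gauss_density_def by (intro mult_right_mono assms) auto
      then show ?thesis by (simp add: mult.assoc mult_exp_exp algebra_simps)
    qed
    then show "AE z in lborel. norm (gauss_density f z) \<le> norm (C * exp (- (1 - a) * (cmod z)\<^sup>2))"
      by (intro AE_I2) (auto simp: gauss_density_nonneg intro: order_trans[OF _ abs_ge_self])
  qed simp
qed (fact assms)

text \<open>Supplies the test vectors of the later arguments. Quadratic growth is absorbed by
  exp(|z|^2/2), where 1/2 is a convenient exponent below 1, using 1 + t \<le> exp t with t =
  |z|^2/2.\<close>

lemma fock_affine: "(\<lambda>z. \<alpha> + \<beta> * z) \<in> fock_space"
proof (rule fock_space_if_bounded_by_exp)
  fix z
  have "(cmod (\<alpha> + \<beta> * z))\<^sup>2 \<le> 2 * (cmod \<alpha>)\<^sup>2 + 2 * (cmod (\<beta> * z))\<^sup>2"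
    using cmod_add_power2_le[of 1 \<alpha> "\<beta> * z"] by simp
  also have "\<dots> \<le> (2 * (cmod \<alpha>)\<^sup>2 + 4 * (cmod \<beta>)\<^sup>2) * exp (1 / 2 * (cmod z)\<^sup>2)"
  proof -
    have "1 + (cmod z)\<^sup>2 / 2 \<le> exp (1 / 2 * (cmod z)\<^sup>2)"
      using exp_ge_add_one_self[of "1 / 2 * (cmod z)\<^sup>2"] by simp
    moreover from this have "(cmod z)\<^sup>2 / 2 \<le> exp (1 / 2 * (cmod z)\<^sup>2)"
      by linarith
    ultimately have "2 * (cmod \<alpha>)\<^sup>2 * 1 \<le> 2 * (cmod \<alpha>)\<^sup>2 * exp (1 / 2 * (cmod z)\<^sup>2)"
      "4 * (cmod \<beta>)\<^sup>2 * ((cmod z)\<^sup>2 / 2) \<le> 4 * (cmod \<beta>)\<^sup>2 * exp (1 / 2 * (cmod z)\<^sup>2)"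
      by (intro mult_left_mono; simp)+
    then show ?thesis
      by (simp add: norm_mult power_mult_distrib algebra_simps)
  qed
  finally show "(cmod (\<alpha> + \<beta> * z))\<^sup>2 \<le> (2 * (cmod \<alpha>)\<^sup>2 + 4 * (cmod \<beta>)\<^sup>2) * exp (1 / 2 * (cmod z)\<^sup>2)" .
qed (auto intro!: holomorphic_intros)

section \<open>Normalised reproducing kernels and the size of the weight\<close>

text \<open>The reproducing kernel at \<open>w\<close> divided by its norm exp(|w|^2/2).\<close>

definition fock_kernel :: "complex \<Rightarrow> complex \<Rightarrow> complex" where
  "fock_kernel w z = exp (cnj w * z - of_real ((cmod w)\<^sup>2 / 2))"

text \<open>Completing the square: the kernel is a Weyl translate of the constant 1. Translation
  invariance then makes its norm independent of \<open>w\<close>.\<close>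

lemma gauss_density_kernel: "gauss_density (fock_kernel w) z = gauss_density (\<lambda>_. 1) (- w + z)"
proof -
  have "(cmod (- w + z))\<^sup>2 = (cmod z)\<^sup>2 + (cmod w)\<^sup>2 - 2 * Re (cnj w * z)"
    unfolding cmod_power2 by (simp add: power2_eq_square algebra_simps)
  then show ?thesis
    by (simp add: gauss_density_def fock_kernel_def power2_eq_square[of "exp _"] mult_exp_exp
      add_divide_distrib algebra_simps)
qed

lemma fock_kernel_holomorphic: "fock_kernel w holomorphic_on UNIV"
  unfolding fock_kernel_def by (intro holomorphic_intros)

lemma fock_kernel:
  "fock_kernel w \<in> fock_space" "fock_norm (fock_kernel w) = fock_norm (\<lambda>_. 1)"
proof -
  have 1: "(\<lambda>_. 1) \<in> fock_space"
    using fock_affine[of 1 0] by simp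
  then have hol1: "(\<lambda>_::complex. 1::complex) holomorphic_on UNIV" and int1: "integrable lborel (gauss_density (\<lambda>_. 1))"
    by (auto simp: fock_space_iff)
  note trans = lborel_translate[OF gauss_density_measurable[OF hol1], of "- w"]
  show "fock_kernel w \<in> fock_space"
    using trans int1 by (simp add: fock_space_iff fock_kernel_holomorphic gauss_density_kernel[abs_def])
  have "(fock_norm (fock_kernel w))\<^sup>2 = (fock_norm (\<lambda>_. 1))\<^sup>2"
    using trans by (simp add: fock_norm_gauss_density fock_kernel_holomorphic gauss_density_kernel[abs_def])
  then show "fock_norm (fock_kernel w) = fock_norm (\<lambda>_. 1)"
    by (simp add: fock_norm_nonneg)
qed

text \<open>Apply the operator to the normalised kernel at \<open>\<psi> z\<close> and evaluate at
  \<open>z\<close>. The kernel has size exp(|\<psi>(z)|^2/2) at its own centre, and the evaluation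
  bound at \<open>z\<close> contributes exp(|z|^2/2).\<close>

lemma fock_bounded_weight_estimate:
  assumes "fock_bounded_operator (weighted_composition u \<psi>)"
  obtains C where "C > 0" "\<And>z. cmod (u z) \<le> C * exp (((cmod z)\<^sup>2 - (cmod (\<psi> z))\<^sup>2) / 2)"
proof -
  obtain E where E: "E > 0"
    "\<And>f w. f \<in> fock_space \<Longrightarrow> cmod (f w) \<le> E * exp ((cmod w)\<^sup>2 / 2) * fock_norm f"
    using fock_eval_bound by blast
  obtain B where B: "\<And>f. f \<in> fock_space \<Longrightarrow> fock_norm (weighted_composition u \<psi> f) \<le> B * fock_norm f"
    and mem: "\<And>f. f \<in> fock_space \<Longrightarrow> weighted_composition u \<psi> f \<in> fock_space"
    using assms unfolding fock_bounded_operator_def by blast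
  \<comment> \<open>The absolute value and the summand 1 make \<open>C\<close> positive whatever the
    sign of \<open>B\<close>.\<close>
  define C where "C = E * (\<bar>B\<bar> * fock_norm (\<lambda>_. 1)) + 1"
  have "C > 0"
    using E(1) by (simp add: C_def fock_norm_nonneg add_nonneg_pos)
  moreover have "cmod (u z) \<le> C * exp (((cmod z)\<^sup>2 - (cmod (\<psi> z))\<^sup>2) / 2)" for z
  proof -
    let ?k = "fock_kernel (\<psi> z)"
    have "cmod (?k (\<psi> z)) = exp ((cmod (\<psi> z))\<^sup>2 / 2)"
      unfolding fock_kernel_def norm_exp_eq_Re cmod_power2 by (simp add: power2_eq_square field_simps)
    then have "cmod (u z) * exp ((cmod (\<psi> z))\<^sup>2 / 2) = cmod (weighted_composition u \<psi> ?k z)"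
      by (simp add: weighted_composition_def norm_mult)
    also have "\<dots> \<le> E * exp ((cmod z)\<^sup>2 / 2) * fock_norm (weighted_composition u \<psi> ?k)"
      by (intro E mem fock_kernel)
    also have "\<dots> \<le> E * exp ((cmod z)\<^sup>2 / 2) * (B * fock_norm ?k)"
      using E(1) by (intro mult_left_mono B fock_kernel) auto
    also have "\<dots> \<le> E * exp ((cmod z)\<^sup>2 / 2) * (\<bar>B\<bar> * fock_norm ?k)"
      using E(1) by (intro mult_left_mono mult_right_mono) (auto simp: fock_norm_nonneg)
    also have "\<dots> \<le> C * exp ((cmod z)\<^sup>2 / 2)"
      by (simp add: C_def fock_kernel algebra_simps)
    finally have "cmod (u z) \<le> C * exp ((cmod z)\<^sup>2 / 2) / exp ((cmod (\<psi> z))\<^sup>2 / 2)"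
      by (subst pos_le_divide_eq) auto
    then show ?thesis
      unfolding diff_divide_distrib exp_diff by simp
  qed
  ultimately show ?thesis using that by blast
qed

section \<open>The symbol and the weight\<close>

text \<open>Schwarz's lemma applies to \<open>f\<close> followed by a Moebius map of a half-plane
  onto the disc. At half the radius it gives |f| \<le> |2M - f|/2, which is then solved for
  |f|.\<close>

lemma Borel_Caratheodory:
  fixes f :: "complex \<Rightarrow> complex"
  assumes hol: "f holomorphic_on UNIV" and 0: "f 0 = 0" and R: "0 < R"
    and Re: "\<And>z. cmod z < R \<Longrightarrow> Re (f z) < M" and z: "cmod z \<le> R / 2"
  shows "cmod (f z) \<le> 2 * M"
proof -
  have M: "M > 0" using Re[of 0] R 0 by simp
  \<comment> \<open>The map w / (2M - w) sends the half-plane Re w < M into the unit disc and fixes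
    0; the argument is rescaled to the unit disc.\<close>
  define F where "F \<zeta> = f (of_real R * \<zeta>) / (of_real (2 * M) - f (of_real R * \<zeta>))" for \<zeta>
  have Re': "Re (f (of_real R * \<zeta>)) < M" if "cmod \<zeta> < 1" for \<zeta>
    using that R by (intro Re) (simp add: norm_mult)
  have nz: "of_real (2 * M) - f (of_real R * \<zeta>) \<noteq> 0" if "cmod \<zeta> < 1" for \<zeta>
    using Re'[OF that] M by (auto simp: complex_eq_iff)
  have lt: "cmod (f (of_real R * \<zeta>)) < cmod (of_real (2 * M) - f (of_real R * \<zeta>))"
    if "cmod \<zeta> < 1" for \<zeta>
  proof -
    have "(cmod (of_real (2 * M) - f (of_real R * \<zeta>)))\<^sup>2 - (cmod (f (of_real R * \<zeta>)))\<^sup>2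
        = 4 * M * (M - Re (f (of_real R * \<zeta>)))"
      unfolding cmod_power2 by (simp add: power2_eq_square algebra_simps)
    also have "\<dots> > 0" using Re'[OF that] M by simp
    finally show ?thesis by (simp add: power2_less_imp_less)
  qed
  have "(\<lambda>\<zeta>. f (of_real R * \<zeta>)) holomorphic_on ball 0 1"
    by (rule holomorphic_on_compose_gen[where f="\<lambda>\<zeta>. of_real R * \<zeta>" and g=f and t=UNIV, unfolded o_def])
      (use hol in \<open>auto intro!: holomorphic_intros\<close>)
  then have holF: "F holomorphic_on ball 0 1"
    unfolding F_def using nz by (intro holomorphic_intros) auto
  define \<zeta> where "\<zeta> = z / of_real R"
  have \<zeta>: "cmod \<zeta> \<le> 1 / 2" "of_real R * \<zeta> = z"
    using z R by (auto simp: \<zeta>_def norm_divide field_simps)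
  have "cmod (F \<zeta>) \<le> cmod \<zeta>"
  proof (rule Schwarz_Lemma(1)[OF holF])
    show "cmod (F x) < 1" if "cmod x < 1" for x
      using lt[OF that] nz[OF that] by (simp add: F_def norm_divide divide_less_eq)
  qed (use \<zeta> 0 in \<open>auto simp: F_def\<close>)
  then have "cmod (f z) / cmod (of_real (2 * M) - f z) \<le> 1 / 2"
    using order_trans[OF _ \<zeta>(1), of "cmod (F \<zeta>)"] by (simp add: F_def \<zeta>(2) norm_divide)
  then have "cmod (f z) \<le> cmod (of_real (2 * M) - f z) / 2"
    using nz[of \<zeta>] \<zeta> by (simp add: pos_divide_le_eq)
  also have "\<dots> \<le> (2 * M + cmod (f z)) / 2"
    using norm_triangle_ineq4[of "of_real (2 * M)" "f z"] M by simp
  finally show ?thesis by simp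
qed

text \<open>For a logarithm h of \<open>u\<close>, the estimate bounds Re h above quadratically,
  hence |h| as well. Read backwards, the same estimate bounds |\<psi>|^2 by a quadratic in |z|, so
  \<psi> is a polynomial of degree at most 1.\<close>

lemma affine_symbol:
  assumes u: "u holomorphic_on UNIV" and \<psi>: "\<psi> holomorphic_on UNIV"
    and nz: "\<And>z. u z \<noteq> 0"
    and bd: "\<And>z. cmod (u z) \<le> C * exp (((cmod z)\<^sup>2 - (cmod (\<psi> z))\<^sup>2) / 2)"
  obtains a b where "\<And>z. \<psi> z = a * z + b" "cmod a \<le> 1"
proof -
  have C: "C > 0"
    using bd[of 0] nz[of 0] by (smt (verit, best) exp_gt_zero mult_nonpos_nonneg zero_less_norm_iff)
  obtain h where h: "h holomorphic_on UNIV" "\<And>z. exp (h z) = u z"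
    using holomorphic_logarithm_exists[of UNIV u 0] u nz by auto
  have Reh: "2 * Re (h z) \<le> 2 * ln C + (cmod z)\<^sup>2 - (cmod (\<psi> z))\<^sup>2" for z
  proof -
    have "exp (Re (h z)) \<le> exp (ln C + ((cmod z)\<^sup>2 - (cmod (\<psi> z))\<^sup>2) / 2)"
      using bd[of z] C by (simp add: exp_add flip: h(2))
    then show ?thesis by (simp add: field_simps)
  qed
  define K where "K = \<bar>ln C\<bar> + cmod (h 0) + 1"
  have h_le: "cmod (h z - h 0) \<le> 2 * (K + 2 * (cmod z)\<^sup>2)" if "z \<noteq> 0" for z
  \<comment> \<open>The radius 2|z| places \<open>z\<close> exactly at half the radius.\<close>
  proof (rule Borel_Caratheodory[where f="\<lambda>z. h z - h 0" and R="2 * cmod z"])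
    fix w assume "cmod w < 2 * cmod z"
    then have "(cmod w)\<^sup>2 \<le> (2 * cmod z)\<^sup>2"
      by (intro power_mono) auto
    moreover have "2 * Re (h w) \<le> 2 * ln C + (cmod w)\<^sup>2"
      using Reh[of w] zero_le_power2[of "cmod (\<psi> w)"] by linarith
    ultimately show "Re (h w - h 0) < K + 2 * (cmod z)\<^sup>2"
      using abs_Re_le_cmod[of "h 0"] by (simp add: K_def power_mult_distrib)
  qed (use that h in \<open>auto intro!: holomorphic_intros\<close>)
  \<comment> \<open>Inserting |h| \<le> 3K + 4|z|^2 and ln C \<le> K into \<open>Reh\<close> gives
    |\<psi>|^2 \<le> 8K + 9|z|^2, which is at most S|z|^2 once |z| \<ge> 1.\<close>
  define S where "S = 9 + 8 * K"
  have K: "K \<ge> 1" by (simp add: K_def)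
  have \<psi>_le: "cmod (\<psi> z) \<le> sqrt S * cmod z ^ 1" if "1 \<le> cmod z" for z
  proof -
    have 1: "1 \<le> (cmod z)\<^sup>2" using that by simp
    have "cmod (h z) \<le> 3 * K + 4 * (cmod z)\<^sup>2"
      using h_le[of z] that norm_triangle_ineq2[of "h z" "h 0"] by (fastforce simp: K_def)
    moreover have "ln C \<le> K"
      using abs_ge_self[of "ln C"] norm_ge_zero[of "h 0"] unfolding K_def by linarith
    moreover have "- Re (h z) \<le> cmod (h z)"
      using complex_Re_le_cmod[of "- h z"] by simp
    ultimately have "(cmod (\<psi> z))\<^sup>2 \<le> 8 * K + 9 * (cmod z)\<^sup>2"
      using Reh[of z] by linarith
    also have "\<dots> = 8 * K * 1 + 9 * (cmod z)\<^sup>2" by simp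
    also have "\<dots> \<le> 8 * K * (cmod z)\<^sup>2 + 9 * (cmod z)\<^sup>2"
      using 1 K by (intro add_mono mult_left_mono) auto
    also have "\<dots> = (sqrt S * cmod z ^ 1)\<^sup>2"
      using K by (simp add: S_def power_mult_distrib algebra_simps)
    finally show ?thesis
      by (rule power2_le_imp_le) (use K in \<open>simp add: S_def\<close>)
  qed
  define a where "a = deriv \<psi> 0"
  define b where "b = \<psi> 0"
  have aff: "\<psi> z = a * z + b" for z
    using Liouville_polynomial[OF \<psi> \<psi>_le, where \<xi>=z] by (simp add: a_def b_def)
  \<comment> \<open>Otherwise |\<psi>(z)| exceeds |z| by a fixed factor for large |z|. The estimate
    then forces \<open>u\<close> to tend to 0 at infinity, and by Liouville \<open>u\<close> has a
    zero.\<close>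
  have "cmod a \<le> 1"
  proof (rule ccontr)
    assume a: "\<not> cmod a \<le> 1"
    \<comment> \<open>The midpoint of 1 and |a|: the gap between \<open>e\<close> and |a| absorbs
      the constant \<open>b\<close> for large |z|, and \<open>e > 1\<close> still leaves
      decay.\<close>
    define e where "e = (cmod a + 1) / 2"
    have e: "e > 1" using a by (simp add: e_def)
    have "\<forall>\<^sub>F z in at_infinity. cmod (u z) \<le> C * exp ((1 - e\<^sup>2) / 2 * (cmod z)\<^sup>2)"
      unfolding eventually_at_infinity
    proof (intro exI allI impI)
      fix z assume z: "2 * cmod b / (cmod a - 1) \<le> cmod z"
      have "e * cmod z \<le> cmod a * cmod z - cmod b"
        using z a by (simp add: e_def field_simps)
      also have "\<dots> \<le> cmod (\<psi> z)"
        using norm_triangle_ineq2[of "a * z" "- b"] by (simp add: aff norm_mult)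
      finally have "(e * cmod z)\<^sup>2 \<le> (cmod (\<psi> z))\<^sup>2"
        using e by (intro power_mono) auto
      then have "((cmod z)\<^sup>2 - (cmod (\<psi> z))\<^sup>2) / 2 \<le> (1 - e\<^sup>2) / 2 * (cmod z)\<^sup>2"
        by (simp add: power_mult_distrib field_simps)
      then show "cmod (u z) \<le> C * exp ((1 - e\<^sup>2) / 2 * (cmod z)\<^sup>2)"
        using C by (intro order_trans[OF bd] mult_left_mono) auto
    qed
    moreover have "((\<lambda>z. C * exp ((1 - e\<^sup>2) / 2 * (cmod z)\<^sup>2)) \<longlongrightarrow> 0) at_infinity"
    proof -
      define k where "k = (1 - e\<^sup>2) / 2"
      have "k < 0" using e by (simp add: k_def one_less_power)
      then have "((\<lambda>r::real. C * exp (k * r\<^sup>2)) \<longlongrightarrow> 0) at_top"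
        by real_asymp
      then show ?thesis
        unfolding k_def by (rule filterlim_compose[OF _ filterlim_norm_at_top])
    qed
    ultimately have "(u \<longlongrightarrow> 0) at_infinity"
      by (rule Lim_null_comparison)
    then show False
      using Liouville_weak[OF u] nz by blast
  qed
  with aff that show ?thesis by blast
qed

text \<open>For a translation the exponent is linear in \<open>z\<close>, namely -Re(cnj b z) -
  |b|^2/2. Multiplying \<open>u\<close> by exp(cnj b z) therefore gives a bounded entire function,
  constant by Liouville.\<close>

lemma translation_weight:
  assumes u: "u holomorphic_on UNIV"
    and bd: "\<And>z. cmod (u z) \<le> C * exp (((cmod z)\<^sup>2 - (cmod (z + b))\<^sup>2) / 2)"
  obtains c where "\<And>z. u z = c * exp (- cnj b * z)"
proof -
  have "cmod (u z * exp (cnj b * z)) \<le> C * exp (- (cmod b)\<^sup>2 / 2)" for z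
  proof -
    have eq: "((cmod z)\<^sup>2 - (cmod (z + b))\<^sup>2) / 2 + Re (cnj b * z) = - (cmod b)\<^sup>2 / 2"
      unfolding cmod_power2 by (simp add: power2_eq_square field_simps)
    have "cmod (u z * exp (cnj b * z)) \<le> C * exp (((cmod z)\<^sup>2 - (cmod (z + b))\<^sup>2) / 2) * exp (Re (cnj b * z))"
      unfolding norm_mult norm_exp_eq_Re by (intro mult_right_mono bd) auto
    then show ?thesis
      unfolding mult.assoc mult_exp_exp eq .
  qed
  then have "bounded (range (\<lambda>z. u z * exp (cnj b * z)))"
    by (auto simp: bounded_iff)
  then have "(\<lambda>z. u z * exp (cnj b * z)) constant_on UNIV"
    by (intro Liouville_theorem holomorphic_intros u)
  then obtain c where c: "\<And>z. u z * exp (cnj b * z) = c"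
    by (auto simp: constant_on_def)
  have "u z = c * exp (- cnj b * z)" for z
    by (simp flip: c[of z] add: mult.assoc mult_exp_exp)
  then show ?thesis using that by blast
qed

section \<open>Projective orbits\<close>

lemma fock_supercyclic_approx:
  assumes "fock_supercyclic T"
  obtains f where "f \<in> fock_space"
    "\<And>g \<epsilon>. g \<in> fock_space \<Longrightarrow> \<epsilon> > 0 \<Longrightarrow> \<exists>c n. (\<lambda>z. c * (T ^^ n) f z) \<in> fock_space \<and> fock_dist g (\<lambda>z. c * (T ^^ n) f z) < \<epsilon>"
proof -
  obtain f where f: "f \<in> fock_space" "Fock.mtopology closure_of projective_orbit T f = fock_space"
    using assms by (auto simp: fock_supercyclic_def)
  have "\<exists>c n. (\<lambda>z. c * (T ^^ n) f z) \<in> fock_space \<and> fock_dist g (\<lambda>z. c * (T ^^ n) f z) < \<epsilon>"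
    if "g \<in> fock_space" "\<epsilon> > 0" for g \<epsilon>
  proof -
    have "g \<in> Fock.mtopology closure_of projective_orbit T f"
      using f(2) \<open>g \<in> fock_space\<close> by simp
    then obtain y where "y \<in> projective_orbit T f" "y \<in> Fock.mball g \<epsilon>"
      using \<open>\<epsilon> > 0\<close> unfolding Fock.metric_closure_of by blast
    then show ?thesis
      by (auto simp: projective_orbit_def Fock.in_mball)
  qed
  with f that show ?thesis by blast
qed

lemma fock_eval_dist:
  obtains E where "E > 0"
    "\<And>f g z. f \<in> fock_space \<Longrightarrow> g \<in> fock_space \<Longrightarrow> cmod (f z - g z) \<le> E * exp ((cmod z)\<^sup>2 / 2) * fock_dist f g"
proof -
  obtain E where E: "E > 0"
    "\<And>f w. f \<in> fock_space \<Longrightarrow> cmod (f w) \<le> E * exp ((cmod w)\<^sup>2 / 2) * fock_norm f"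
    using fock_eval_bound by blast
  show ?thesis
    by (rule that[OF E(1)]) (use E(2)[OF fock_diff] in \<open>simp add: fock_dist_def\<close>)
qed

text \<open>Continuity of the derivative at \<open>p\<close>, by Cauchy's inequality on the unit
  circle around \<open>p\<close>, where the evaluation bound is uniform.\<close>

lemma fock_deriv_dist:
  obtains D where "D > 0"
    "\<And>f g. f \<in> fock_space \<Longrightarrow> g \<in> fock_space \<Longrightarrow> cmod (deriv f p - deriv g p) \<le> D * fock_dist f g"
proof -
  obtain E where E: "E > 0"
    "\<And>f w. f \<in> fock_space \<Longrightarrow> cmod (f w) \<le> E * exp ((cmod w)\<^sup>2 / 2) * fock_norm f"
    using fock_eval_bound by blast
  define D where "D = E * exp ((cmod p + 1)\<^sup>2 / 2)"
  have "D > 0" using E by (simp add: D_def)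
  moreover have "cmod (deriv f p - deriv g p) \<le> D * fock_dist f g"
    if f: "f \<in> fock_space" and g: "g \<in> fock_space" for f g
  proof -
    let ?h = "\<lambda>z. f z - g z"
    have h: "?h \<in> fock_space" by (rule fock_diff[OF f g])
    then have hol: "?h holomorphic_on UNIV" by (simp add: fock_space_iff)
    have "cmod ((deriv ^^ 1) ?h p) \<le> fact 1 * (D * fock_dist f g) / 1 ^ 1"
    proof (rule Cauchy_inequality)
      fix x assume x: "cmod (p - x) = 1"
      have "cmod x \<le> cmod p + 1"
        using x norm_triangle_ineq2[of x p] by (simp add: norm_minus_commute)
      then have "exp ((cmod x)\<^sup>2 / 2) \<le> exp ((cmod p + 1)\<^sup>2 / 2)"
        by (simp add: power_mono)
      then have "E * exp ((cmod x)\<^sup>2 / 2) * fock_norm ?h \<le> E * exp ((cmod p + 1)\<^sup>2 / 2) * fock_norm ?h"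
        using E(1) by (intro mult_right_mono mult_left_mono) (auto simp: fock_norm_nonneg)
      then show "cmod (?h x) \<le> D * fock_dist f g"
        using E(2)[OF h, of x] by (simp add: D_def fock_dist_def)
    qed (auto intro: holomorphic_on_subset[OF hol] holomorphic_on_imp_continuous_on)
    moreover have "deriv ?h p = deriv f p - deriv g p"
      using f g by (intro deriv_diff holomorphic_on_imp_differentiable_at[of _ UNIV]) (auto simp: fock_space_iff)
    ultimately show ?thesis by simp
  qed
  ultimately show ?thesis using that by blast
qed

section \<open>Lines spanned by the iterates\<close>

text \<open>A line is closed, and the value 1 at \<open>p\<close> fixes the scalar. Evaluation at
  \<open>p\<close> and at \<open>z\<close> sends c h(p) to 1 and c h(z) to g(z), so h(p) g(z) =
  h(z).\<close>

lemma fock_limit_of_line: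
  assumes h: "h \<in> fock_space" and g: "g \<in> fock_space" and gp: "g p = 1"
    and lim: "\<And>\<epsilon>. \<epsilon> > 0 \<Longrightarrow> \<exists>c. fock_dist g (\<lambda>z. c * h z) < \<epsilon>"
  shows "g z = h z / h p"
proof -
  obtain E where E: "E > 0"
    "\<And>f g z. f \<in> fock_space \<Longrightarrow> g \<in> fock_space \<Longrightarrow> cmod (f z - g z) \<le> E * exp ((cmod z)\<^sup>2 / 2) * fock_dist f g"
    using fock_eval_dist by blast
  define B where "B = E * exp ((cmod z)\<^sup>2 / 2) + E * exp ((cmod p)\<^sup>2 / 2)"
  have B: "B > 0" using E(1) by (simp add: B_def add_pos_pos)
  have close: "\<exists>c. cmod (g z - c * h z) < \<epsilon> \<and> cmod (1 - c * h p) < \<epsilon>" if \<epsilon>: "\<epsilon> > 0" for \<epsilon>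
  proof -
    obtain c where c: "fock_dist g (\<lambda>z. c * h z) < \<epsilon> / B"
      using lim[OF divide_pos_pos[OF \<epsilon> B]] ..
    let ?d = "fock_dist g (\<lambda>z. c * h z)"
    have d: "?d \<ge> 0" by (simp add: fock_dist_def fock_norm_nonneg)
    have "E * exp ((cmod w)\<^sup>2 / 2) * ?d < \<epsilon>" if "w = z \<or> w = p" for w
    proof -
      have "E * exp ((cmod w)\<^sup>2 / 2) * ?d \<le> B * ?d"
        using that E(1) d by (intro mult_right_mono) (auto simp: B_def)
      also have "\<dots> < \<epsilon>" using c B by (simp add: field_simps)
      finally show ?thesis .
    qed
    then show ?thesis
      using order_le_less_trans[OF E(2)[OF g fock_scale[OF h, of c], of z]]
        order_le_less_trans[OF E(2)[OF g fock_scale[OF h, of c], of p]] gp by auto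
  qed
  have "cmod (h p * g z - h z) \<le> 0"
  proof (rule field_le_epsilon)
    fix e :: real assume e: "e > 0"
    define m where "m = cmod (h p) + cmod (h z) + 1"
    have m: "m > 0" unfolding m_def by (smt (verit) norm_ge_zero)
    obtain c where c: "cmod (g z - c * h z) < e / m" "cmod (1 - c * h p) < e / m"
      using close[of "e / m"] e m by auto
    \<comment> \<open>The terms containing \<open>c\<close> cancel, which expresses the defect by
      two errors that are both small.\<close>
    have "h p * g z - h z = h p * (g z - c * h z) - h z * (1 - c * h p)"
      by (simp add: algebra_simps)
    also have "cmod \<dots> \<le> cmod (h p) * cmod (g z - c * h z) + cmod (h z) * cmod (1 - c * h p)"
      using norm_triangle_ineq4 by (metis norm_mult)
    also have "\<dots> \<le> cmod (h p) * (e / m) + cmod (h z) * (e / m)"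
      using c by (intro add_mono mult_left_mono) auto
    also have "\<dots> = e * ((cmod (h p) + cmod (h z)) / m)"
      by (simp add: add_divide_distrib distrib_left mult.commute)
    also have "\<dots> \<le> e * 1"
      using m e by (intro mult_left_mono) (auto simp: m_def)
    finally show "cmod (h p * g z - h z) \<le> 0 + e" by simp
  qed
  moreover have "h p \<noteq> 0"
    using close[of 1] by auto
  ultimately show ?thesis by (simp add: field_simps)
qed

text \<open>If only finitely many exponents occur near \<open>g\<close>, a single one approximates
  \<open>g\<close> arbitrarily well, so \<open>g\<close> lies on the line of that iterate. Countably
  many lines cannot contain a one-parameter real family of normalised functions.\<close>

lemma not_supercyclic_if_bounded_exponents:
  assumes T: "\<And>f. f \<in> fock_space \<Longrightarrow> T f \<in> fock_space"
    and f: "f \<in> fock_space"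
    and approx: "\<And>g \<epsilon>. g \<in> fock_space \<Longrightarrow> \<epsilon> > 0 \<Longrightarrow>
      \<exists>c n. (\<lambda>z. c * (T ^^ n) f z) \<in> fock_space \<and> fock_dist g (\<lambda>z. c * (T ^^ n) f z) < \<epsilon>"
    and bounded: "\<And>g. g \<in> fock_space \<Longrightarrow> g p = 1 \<Longrightarrow>
      \<exists>N \<epsilon>. \<epsilon> > 0 \<and> (\<forall>c n. fock_dist g (\<lambda>z. c * (T ^^ n) f z) < \<epsilon> \<longrightarrow> n \<le> N)"
  shows False
proof -
  have Tn: "(T ^^ n) f \<in> fock_space" for n
    by (induction n) (auto intro: f T)
  have key: "\<exists>n. \<forall>z. g z = (T ^^ n) f z / (T ^^ n) f p" if g: "g \<in> fock_space" "g p = 1" for g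
  proof -
    obtain N \<epsilon> where N: "\<epsilon> > 0" "\<And>c n. fock_dist g (\<lambda>z. c * (T ^^ n) f z) < \<epsilon> \<Longrightarrow> n \<le> N"
      using bounded[OF g] by blast
    have "\<exists>n\<le>N. \<forall>\<delta>>0. \<exists>c. fock_dist g (\<lambda>z. c * (T ^^ n) f z) < \<delta>"
    proof (rule ccontr)
      assume "\<not> ?thesis"
      then obtain \<delta> where \<delta>: "\<And>n. n \<le> N \<Longrightarrow> \<delta> n > 0 \<and> (\<forall>c. \<not> fock_dist g (\<lambda>z. c * (T ^^ n) f z) < \<delta> n)"
        by metis
      \<comment> \<open>If each exponent up to \<open>N\<close> stays some distance away from
        \<open>g\<close>, the minimum of these finitely many distances, capped by
        \<open>\<epsilon>\<close>, contradicts density.\<close>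
      define e where "e = min \<epsilon> (Min (\<delta> ` {..N}))"
      have "e > 0" using \<delta> N(1) by (auto simp: e_def)
      then obtain c n where cn: "fock_dist g (\<lambda>z. c * (T ^^ n) f z) < e"
        using approx[OF g(1)] by blast
      then have "n \<le> N" using N(2) by (auto simp: e_def)
      then have "e \<le> \<delta> n" by (auto simp: e_def min_le_iff_disj)
      with cn \<delta>[OF \<open>n \<le> N\<close>] show False by (meson order_less_le_trans)
    qed
    then obtain n where "\<And>\<delta>. \<delta> > 0 \<Longrightarrow> \<exists>c. fock_dist g (\<lambda>z. c * (T ^^ n) f z) < \<delta>"
      by blast
    then show ?thesis
      using fock_limit_of_line[OF Tn g] by blast
  qed
  \<comment> \<open>All members take the value 1 at \<open>p\<close>, so equal exponents mean equal
    functions; evaluation at \<open>p + 1\<close> then recovers \<open>t\<close>.\<close>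
  have "\<exists>n. \<forall>z. 1 + of_real t * (z - p) = (T ^^ n) f z / (T ^^ n) f p" for t :: real
  proof (rule key)
    show "(\<lambda>z. 1 + of_real t * (z - p)) \<in> fock_space"
      using fock_affine[of "1 - of_real t * p" "of_real t"] by (simp add: algebra_simps)
  qed simp
  then obtain N where N: "\<And>t z. 1 + of_real t * (z - p) = (T ^^ N t) f z / (T ^^ N t) f p"
    by metis
  have "inj (N :: real \<Rightarrow> nat)"
  proof (rule injI)
    fix s t assume "N s = N t"
    then have "1 + complex_of_real s * (p + 1 - p) = 1 + complex_of_real t * (p + 1 - p)"
      by (simp only: N)
    then show "s = t" by simp
  qed
  then have "countable (UNIV :: real set)"
    by (rule countableI)
  then show False
    using uncountable_UNIV_real by blast
qed

section \<open>Symbols with a fixed point, weights with a zero, translations\<close>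

text \<open>Each application of the operator multiplies the value at \<open>p\<close> by
  \<open>u p\<close> and the functional \<open>L\<close> by \<open>u p * deriv \<psi> p\<close>.
  Hence the ratio of |L| to the modulus at \<open>p\<close> never grows along the orbit. The
  condition on \<open>\<kappa>\<close> is what makes \<open>L\<close> an eigenvector of the
  adjoint.\<close>

lemma fixed_point_not_supercyclic:
  assumes u: "u holomorphic_on UNIV" and \<psi>: "\<psi> holomorphic_on UNIV"
    and T: "\<And>f. f \<in> fock_space \<Longrightarrow> weighted_composition u \<psi> f \<in> fock_space"
    and p: "\<psi> p = p" and d: "cmod (deriv \<psi> p) \<le> 1"
    and \<kappa>: "deriv u p = \<kappa> * u p * (1 - deriv \<psi> p)"
  shows "\<not> fock_supercyclic (weighted_composition u \<psi>)"
proof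
  let ?T = "weighted_composition u \<psi>"
  assume "fock_supercyclic ?T"
  then obtain f where f: "f \<in> fock_space"
    and approx: "\<And>g \<epsilon>. g \<in> fock_space \<Longrightarrow> \<epsilon> > 0 \<Longrightarrow>
      \<exists>c n. (\<lambda>z. c * (?T ^^ n) f z) \<in> fock_space \<and> fock_dist g (\<lambda>z. c * (?T ^^ n) f z) < \<epsilon>"
    by (rule fock_supercyclic_approx) blast
  define L where "L g = deriv g p - \<kappa> * g p" for g
  obtain E where E: "E > 0"
    "\<And>f g z. f \<in> fock_space \<Longrightarrow> g \<in> fock_space \<Longrightarrow> cmod (f z - g z) \<le> E * exp ((cmod z)\<^sup>2 / 2) * fock_dist f g"
    using fock_eval_dist by blast
  obtain D where D: "D > 0"
    "\<And>f g. f \<in> fock_space \<Longrightarrow> g \<in> fock_space \<Longrightarrow> cmod (deriv f p - deriv g p) \<le> D * fock_dist f g"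
    using fock_deriv_dist by blast
  define B where "B = D + (cmod \<kappa> + 1) * (E * exp ((cmod p)\<^sup>2 / 2))"
  have B: "B > 0" using D(1) E(1) by (auto simp: B_def intro!: add_pos_nonneg)
  have Tn: "(?T ^^ n) f \<in> fock_space" for n
    by (induction n) (auto intro: f T)
  have diff: "h field_differentiable at z" if "h holomorphic_on UNIV" for h :: "complex \<Rightarrow> complex" and z
    using that holomorphic_on_imp_differentiable_at by blast
  have step: "?T h p = u p * h p" "L (?T h) = u p * deriv \<psi> p * L h" if h: "h \<in> fock_space" for h
  proof -
    show "?T h p = u p * h p" by (simp add: weighted_composition_def p)
    have hol: "h holomorphic_on UNIV" using h by (simp add: fock_space_iff)
    have "(?T h has_field_derivative deriv u p * h (\<psi> p) + deriv h (\<psi> p) * deriv \<psi> p * u p) (at p)"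
      unfolding weighted_composition_def
      by (intro DERIV_mult DERIV_chain2[where f=h] field_differentiable_derivI diff hol u \<psi>)
    then have "deriv (?T h) p = deriv u p * h p + deriv h p * deriv \<psi> p * u p"
      unfolding p by (rule DERIV_imp_deriv)
    then show "L (?T h) = u p * deriv \<psi> p * L h"
      by (simp add: L_def \<kappa> weighted_composition_def p algebra_simps)
  qed
  have Mn: "(?T ^^ n) f p = u p ^ n * f p" for n
    by (induction n) (simp_all add: step Tn)
  have Ln: "L ((?T ^^ n) f) = (u p * deriv \<psi> p) ^ n * L f" for n
    by (induction n) (simp_all add: step Tn)
  have Lc: "L (\<lambda>z. c * h z) = c * L h" if "h \<in> fock_space" for c h
  proof -
    have "h field_differentiable at p" using that by (intro diff) (simp add: fock_space_iff)
    then show ?thesis by (simp add: L_def algebra_simps)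
  qed
  \<comment> \<open>The factors \<open>c\<close> and \<open>u p ^ n\<close> are common to both
    sides; only the power of \<open>deriv \<psi> p\<close> remains, and its modulus is at most
    1.\<close>
  have bound: "cmod (L (\<lambda>z. c * (?T ^^ n) f z)) * cmod (f p) \<le> cmod (L f) * cmod (c * (?T ^^ n) f p)" for c n
  proof -
    have "cmod (deriv \<psi> p) ^ n \<le> 1" using d by (simp add: power_le_one)
    then have "cmod (c * u p ^ n * L f * f p) * cmod (deriv \<psi> p) ^ n \<le> cmod (c * u p ^ n * L f * f p) * 1"
      by (intro mult_left_mono) auto
    then show ?thesis
      by (simp add: Lc Tn Mn Ln norm_mult norm_power power_mult_distrib mult_ac)
  qed
  have close: "\<exists>c n. cmod (L g - L (\<lambda>z. c * (?T ^^ n) f z)) < \<epsilon> \<and> cmod (g p - c * (?T ^^ n) f p) < \<epsilon>"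
    if g: "g \<in> fock_space" and \<epsilon>: "\<epsilon> > 0" for g \<epsilon>
  proof -
    obtain c n where cn: "(\<lambda>z. c * (?T ^^ n) f z) \<in> fock_space" "fock_dist g (\<lambda>z. c * (?T ^^ n) f z) < \<epsilon> / B"
      using approx[OF g divide_pos_pos[OF \<epsilon> B]] by blast
    let ?h = "\<lambda>z. c * (?T ^^ n) f z" and ?e = "E * exp ((cmod p)\<^sup>2 / 2)"
    let ?d = "fock_dist g ?h"
    have d0: "?d \<ge> 0" by (simp add: fock_dist_def fock_norm_nonneg)
    have Bd: "B * ?d < \<epsilon>" using cn(2) B by (simp add: field_simps)
    have M: "cmod (g p - ?h p) \<le> ?e * ?d" using E(2)[OF g cn(1)] .
    have "L g - L ?h = (deriv g p - deriv ?h p) - \<kappa> * (g p - ?h p)"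
      by (simp add: L_def algebra_simps)
    then have "cmod (L g - L ?h) \<le> cmod (deriv g p - deriv ?h p) + cmod \<kappa> * cmod (g p - ?h p)"
      using norm_triangle_ineq4 by (metis norm_mult)
    also have "\<dots> \<le> D * ?d + cmod \<kappa> * (?e * ?d)"
      using D(2)[OF g cn(1)] M by (intro add_mono mult_left_mono) auto
    also have "\<dots> \<le> B * ?d"
      using d0 E(1) by (simp add: B_def algebra_simps)
    finally have "cmod (L g - L ?h) < \<epsilon>" using Bd by simp
    moreover have "?e * ?d \<le> B * ?d"
      using d0 E(1) D(1) by (intro mult_right_mono) (auto simp: B_def algebra_simps)
    ultimately show ?thesis using M Bd by fastforce
  qed
  have test: "(\<lambda>z. 1 + t * (z - p)) \<in> fock_space" for t
    using fock_affine[of "1 - t * p" t] by (simp add: algebra_simps)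
  have Ltest: "L (\<lambda>z. 1 + t * (z - p)) = t - \<kappa>" for t
  proof -
    have "((\<lambda>z. 1 + t * (z - p)) has_field_derivative t) (at p)"
      by (auto intro!: derivative_eq_intros)
    then show ?thesis using DERIV_imp_deriv by (simp add: L_def)
  qed
  \<comment> \<open>If \<open>f\<close> vanished at \<open>p\<close>, so would its whole orbit, and
    the constant 1 could not be approximated within 1 at \<open>p\<close>.\<close>
  have fp: "f p \<noteq> 0"
    using close[OF test, of 1 0] by (auto simp: Mn)
  define R where "R = cmod (L f) / cmod (f p)"
  have R: "R \<ge> 0" by (simp add: R_def)
  \<comment> \<open>The target has value 1 at \<open>p\<close> and \<open>L\<close>-value
    \<open>R + 1\<close>, above the admissible ratio \<open>R\<close>. An approximation within
    \<open>e\<close> would give R + 1 - e \<le> R (1 + e), that is 1 \<le> e (1 + R) = 1/2.\<close>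
  define e where "e = 1 / (2 * (1 + R))"
  have e: "e > 0" "e * (1 + R) = 1 / 2" using R by (auto simp: e_def)
  obtain c n where cn: "cmod (of_real (R + 1) - L (\<lambda>z. c * (?T ^^ n) f z)) < e" "cmod (1 - c * (?T ^^ n) f p) < e"
    using close[OF test e(1), of "of_real (R + 1) + \<kappa>"] by (auto simp: Ltest)
  have "R + 1 - e \<le> cmod (L (\<lambda>z. c * (?T ^^ n) f z))"
    using cn(1) norm_triangle_ineq2[of "of_real (R + 1)" "L (\<lambda>z. c * (?T ^^ n) f z)"] R
    by (simp del: of_real_add)
  also have "\<dots> \<le> R * cmod (c * (?T ^^ n) f p)"
    using bound[of c n] fp by (simp add: R_def field_simps)
  also have "\<dots> \<le> R * (1 + e)"
    using R cn(2) norm_triangle_ineq3[of 1 "c * (?T ^^ n) f p"] by (intro mult_left_mono) auto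
  finally show False
    using e(2) by (simp add: algebra_simps)
qed

text \<open>Near a function with value 1 at \<open>p\<close> only the exponent 0 can occur, since
  every later iterate vanishes there. Thus the bound on the exponents is 0.\<close>

lemma vanishing_weight_not_supercyclic:
  assumes T: "\<And>f. f \<in> fock_space \<Longrightarrow> weighted_composition u \<psi> f \<in> fock_space"
    and p: "u p = 0"
  shows "\<not> fock_supercyclic (weighted_composition u \<psi>)"
proof
  let ?T = "weighted_composition u \<psi>"
  assume "fock_supercyclic ?T"
  then obtain f where f: "f \<in> fock_space"
    and approx: "\<And>g \<epsilon>. g \<in> fock_space \<Longrightarrow> \<epsilon> > 0 \<Longrightarrow>
      \<exists>c n. (\<lambda>z. c * (?T ^^ n) f z) \<in> fock_space \<and> fock_dist g (\<lambda>z. c * (?T ^^ n) f z) < \<epsilon>"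
    by (rule fock_supercyclic_approx) blast
  obtain E where E: "E > 0"
    "\<And>f g z. f \<in> fock_space \<Longrightarrow> g \<in> fock_space \<Longrightarrow> cmod (f z - g z) \<le> E * exp ((cmod z)\<^sup>2 / 2) * fock_dist f g"
    using fock_eval_dist by blast
  have Tn: "(?T ^^ n) f \<in> fock_space" for n
    by (induction n) (auto intro: f T)
  show False
  proof (rule not_supercyclic_if_bounded_exponents[OF T f approx])
    fix g assume g: "g \<in> fock_space" "g p = 1"
    \<comment> \<open>At this distance the error at \<open>p\<close> is less than 1.\<close>
    define \<epsilon> where "\<epsilon> = 1 / (E * exp ((cmod p)\<^sup>2 / 2))"
    have "n \<le> 0" if "fock_dist g (\<lambda>z. c * (?T ^^ n) f z) < \<epsilon>" for c n
    proof (rule ccontr)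
      assume "\<not> n \<le> 0"
      then obtain m where "n = Suc m" by (cases n) auto
      then have "(?T ^^ n) f p = 0" by (simp add: weighted_composition_def p)
      then have "1 \<le> E * exp ((cmod p)\<^sup>2 / 2) * fock_dist g (\<lambda>z. c * (?T ^^ n) f z)"
        using E(2)[OF g(1) fock_scale[OF Tn[of n], of c], of p] g(2) by simp
      also have "\<dots> < 1"
        using that E(1) by (simp add: \<epsilon>_def field_simps)
      finally show False by simp
    qed
    moreover have "\<epsilon> > 0" using E(1) by (simp add: \<epsilon>_def)
    ultimately show "\<exists>N \<epsilon>. \<epsilon> > 0 \<and> (\<forall>c n. fock_dist g (\<lambda>z. c * (?T ^^ n) f z) < \<epsilon> \<longrightarrow> n \<le> N)"
      by blast
  qed
qed

text \<open>The squared norm of the n-th iterate is \<open>\<rho> ^ n\<close> times that of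
  \<open>f\<close>, while its squared value at 0 is \<open>\<rho> ^ n\<close> times the density of
  \<open>f\<close> at n b, which tends to 0. A scalar multiple of bounded norm is therefore small at
  0 for large n.\<close>

lemma translation_not_supercyclic:
  assumes T: "\<And>f. f \<in> fock_space \<Longrightarrow> weighted_composition u \<psi> f \<in> fock_space"
    and u: "\<And>z. u z = k * exp (- cnj b * z)" and \<psi>: "\<And>z. \<psi> z = z + b" and b: "b \<noteq> 0"
  shows "\<not> fock_supercyclic (weighted_composition u \<psi>)"
proof
  let ?T = "weighted_composition u \<psi>"
  assume "fock_supercyclic ?T"
  then obtain f where f: "f \<in> fock_space"
    and approx: "\<And>g \<epsilon>. g \<in> fock_space \<Longrightarrow> \<epsilon> > 0 \<Longrightarrow>
      \<exists>c n. (\<lambda>z. c * (?T ^^ n) f z) \<in> fock_space \<and> fock_dist g (\<lambda>z. c * (?T ^^ n) f z) < \<epsilon>"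
    by (rule fock_supercyclic_approx) blast
  obtain E where E: "E > 0"
    "\<And>f g z. f \<in> fock_space \<Longrightarrow> g \<in> fock_space \<Longrightarrow> cmod (f z - g z) \<le> E * exp ((cmod z)\<^sup>2 / 2) * fock_dist f g"
    using fock_eval_dist by blast
  have Tn: "(?T ^^ n) f \<in> fock_space" for n
    by (induction n) (auto intro: f T)
  have hol: "f holomorphic_on UNIV" using f by (simp add: fock_space_iff)
  \<comment> \<open>The square of the factor by which the operator scales norms; dividing by its
    root leaves a Weyl isometry.\<close>
  define \<rho> where "\<rho> = (cmod k)\<^sup>2 * exp ((cmod b)\<^sup>2)"
  have step: "gauss_density (?T h) z = \<rho> * gauss_density h (b + z)" for h z
  proof -
    have "(cmod (b + z))\<^sup>2 = (cmod z)\<^sup>2 + (cmod b)\<^sup>2 + 2 * Re (cnj b * z)"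
      unfolding cmod_power2 by (simp add: power2_eq_square algebra_simps)
    then have "exp (- (cmod z)\<^sup>2) * (exp (Re (- cnj b * z)))\<^sup>2 = exp ((cmod b)\<^sup>2) * exp (- (cmod (b + z))\<^sup>2)"
      by (simp add: power2_eq_square[of "exp _"] mult_exp_exp algebra_simps)
    then show ?thesis
      by (simp add: gauss_density_def weighted_composition_def u \<psi> norm_mult power_mult_distrib \<rho>_def
          add.commute mult_ac)
  qed
  have dn: "gauss_density ((?T ^^ n) f) z = \<rho> ^ n * gauss_density f (of_nat n * b + z)" for n z
  proof (induction n arbitrary: z)
    case (Suc n)
    show ?case by (simp add: step Suc algebra_simps)
  qed simp
  have norm_n: "(fock_norm ((?T ^^ n) f))\<^sup>2 = \<rho> ^ n * (fock_norm f)\<^sup>2" for n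
  proof -
    have "(?T ^^ n) f holomorphic_on UNIV" using Tn by (simp add: fock_space_iff)
    then show ?thesis
      by (simp add: fock_norm_gauss_density hol dn lborel_translate gauss_density_measurable)
  qed
  \<comment> \<open>A vector of norm 0 has only the zero function in its orbit, which stays at
    positive distance from the constant 1.\<close>
  have f0: "fock_norm f > 0"
  proof (rule ccontr)
    assume "\<not> fock_norm f > 0"
    then have "fock_norm f = 0" using fock_norm_nonneg[of f] by simp
    then have "fock_norm ((?T ^^ n) f) = 0" for n using norm_n[of n] by simp
    then have zero: "(?T ^^ n) f z = 0" for n z using fock_norm_eq_0[OF Tn] by blast
    have one: "(\<lambda>_. 1) \<in> fock_space" using fock_affine[of 1 0] by simp
    let ?d = "fock_dist (\<lambda>_. 1) (\<lambda>_. 0)"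
    have "1 \<le> E * ?d"
      using E(2)[OF one fock_scale[OF one, of 0], of 0] by simp
    then have "?d > 0" using E(1) by (smt (verit) mult_nonneg_nonpos)
    then show False
      using approx[OF one, of ?d] by (auto simp: zero)
  qed
  show False
  proof (rule not_supercyclic_if_bounded_exponents[OF T f approx])
    fix g assume g: "g \<in> fock_space" "g 0 = 1"
    \<comment> \<open>Chosen so that the error at 0 is below 1/2, which keeps the approximant at
      least 1/2 in modulus there.\<close>
    define \<epsilon> where "\<epsilon> = 1 / (2 * E)"
    have \<epsilon>: "\<epsilon> > 0" using E(1) by (simp add: \<epsilon>_def)
    define G where "G = fock_norm g + \<epsilon>"
    have G: "G > 0" using \<epsilon> by (simp add: G_def add_nonneg_pos fock_norm_nonneg)
    \<comment> \<open>\<open>G\<close> bounds the norm of every approximant within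
      \<open>\<epsilon>\<close>, so \<open>?x\<close> times the squared norm of \<open>f\<close> is
      at most the square of \<open>G\<close>. This \<open>\<delta>\<close> turns that into a squared
      value at 0 below 1/4, contradicting \<open>low\<close>.\<close>
    define \<delta> where "\<delta> = (fock_norm f)\<^sup>2 / (4 * G\<^sup>2)"
    have "\<delta> > 0" using f0 G by (simp add: \<delta>_def)
    then obtain N where N: "\<And>n. n \<ge> N \<Longrightarrow> gauss_density f (of_nat n * b) < \<delta>"
      using gauss_density_tendsto_0[OF f b] unfolding order_tendsto_iff eventually_sequentially by blast
    have "n \<le> N" if dist: "fock_dist g (\<lambda>z. c * (?T ^^ n) f z) < \<epsilon>" for c n
    proof (rule ccontr)
      assume n: "\<not> n \<le> N"
      let ?h = "\<lambda>z. c * (?T ^^ n) f z"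
      have h: "?h \<in> fock_space" by (intro fock_scale Tn)
      have "cmod (g 0 - ?h 0) \<le> E * fock_dist g ?h"
        using E(2)[OF g(1) h, of 0] by simp
      also have "\<dots> < 1 / 2"
        using dist E(1) by (simp add: \<epsilon>_def field_simps)
      finally have "1 / 2 \<le> cmod (?h 0)"
        using g(2) norm_triangle_ineq2[of 1 "?h 0"] by simp
      then have "(1 / 2)\<^sup>2 \<le> (cmod (?h 0))\<^sup>2"
        by (intro power_mono) auto
      also have "\<dots> = (cmod c)\<^sup>2 * (\<rho> ^ n * gauss_density f (of_nat n * b))"
        using dn[of n 0] by (simp add: gauss_density_def norm_mult power_mult_distrib)
      finally have low: "1 / 4 \<le> (cmod c)\<^sup>2 * \<rho> ^ n * gauss_density f (of_nat n * b)"
        by (simp add: power2_eq_square mult_ac)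
      have "fock_norm ?h \<le> G"
      proof -
        have "fock_norm (\<lambda>z. g z + (?h z - g z)) \<le> fock_norm g + fock_norm (\<lambda>z. ?h z - g z)"
          by (intro fock_norm_triangle fock_diff g h)
        moreover have "fock_norm (\<lambda>z. ?h z - g z) = fock_dist g ?h"
          by (simp add: fock_dist_def fock_norm_eq norm_minus_commute)
        ultimately show ?thesis using dist by (simp add: G_def)
      qed
      then have "(fock_norm ?h)\<^sup>2 \<le> G\<^sup>2"
        by (intro power_mono fock_norm_nonneg)
      moreover have "(fock_norm ?h)\<^sup>2 = (cmod c)\<^sup>2 * (fock_norm ((?T ^^ n) f))\<^sup>2"
        by (simp add: fock_norm_power2 norm_mult power_mult_distrib)
      ultimately have up: "(cmod c)\<^sup>2 * \<rho> ^ n * (fock_norm f)\<^sup>2 \<le> G\<^sup>2"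
        by (simp add: norm_n mult.assoc)
      let ?x = "(cmod c)\<^sup>2 * \<rho> ^ n"
      \<comment> \<open>This also disposes of \<open>k = 0\<close>, where \<open>\<rho>\<close>
        vanishes: the lower bound at 0 could not hold.\<close>
      have x: "?x > 0"
      proof (rule ccontr)
        assume "\<not> ?x > 0"
        then have "?x * gauss_density f (of_nat n * b) \<le> 0"
          by (intro mult_nonpos_nonneg[OF _ gauss_density_nonneg]) linarith
        with low show False by simp
      qed
      have "?x * gauss_density f (of_nat n * b) < ?x * \<delta>"
        using N[of n] n x by (intro mult_strict_left_mono) auto
      also have "\<dots> = ?x * (fock_norm f)\<^sup>2 / (4 * G\<^sup>2)" by (simp add: \<delta>_def)
      also have "\<dots> \<le> G\<^sup>2 / (4 * G\<^sup>2)"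
        by (intro divide_right_mono up) simp
      also have "\<dots> = 1 / 4" using G by simp
      finally show False using low by simp
    qed
    with \<epsilon> show "\<exists>N \<epsilon>. \<epsilon> > 0 \<and> (\<forall>c n. fock_dist g (\<lambda>z. c * (?T ^^ n) f z) < \<epsilon> \<longrightarrow> n \<le> N)"
      by blast
  qed
qed

section \<open>Case distinction by zeros of the weight and slope of the symbol\<close>

theorem theorem2p2:
  fixes u \<psi> :: "complex \<Rightarrow> complex"
  assumes "u holomorphic_on UNIV" and "\<psi> holomorphic_on UNIV"
    and "fock_bounded_operator (weighted_composition u \<psi>)"
  shows "\<not> fock_supercyclic (weighted_composition u \<psi>)"
proof -
  have T: "\<And>f. f \<in> fock_space \<Longrightarrow> weighted_composition u \<psi> f \<in> fock_space"
    using assms(3) by (simp add: fock_bounded_operator_def)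
  show ?thesis
  proof (cases "\<exists>p. u p = 0")
    case True
    then show ?thesis
      using vanishing_weight_not_supercyclic[OF T] by blast
  next
    case False
    obtain C where C: "\<And>z. cmod (u z) \<le> C * exp (((cmod z)\<^sup>2 - (cmod (\<psi> z))\<^sup>2) / 2)"
      using fock_bounded_weight_estimate[OF assms(3)] by blast
    obtain a b where ab: "\<And>z. \<psi> z = a * z + b" "cmod a \<le> 1"
      using affine_symbol[OF assms(1,2) _ C] False by blast
    have deriv: "deriv \<psi> p = a" for p
      unfolding ab(1)[abs_def] by (intro DERIV_imp_deriv) (auto intro!: derivative_eq_intros)
    show ?thesis
    proof (cases "a = 1")
      case True
      then have \<psi>: "\<psi> z = z + b" for z by (simp add: ab)
      obtain k where k: "\<And>z. u z = k * exp (- cnj b * z)"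
        using translation_weight[OF assms(1), of C b] C by (auto simp: \<psi>)
      show ?thesis
      proof (cases "b = 0")
        case True
        \<comment> \<open>Here the operator is a multiple of the identity: \<open>u\<close> is
          constant and every point is fixed, so \<open>p = 0\<close> and \<open>\<kappa> = 0\<close>
          serve.\<close>
        have "deriv u 0 = 0"
          unfolding k[abs_def] True by simp
        then show ?thesis
          using True \<open>a = 1\<close> deriv ab
          by (intro fixed_point_not_supercyclic[where p=0 and \<kappa>=0] assms T) auto
      qed (use translation_not_supercyclic[OF T k \<psi>] in blast)
    next
      case a: False
      \<comment> \<open>The unique fixed point of an affine map of slope different from 1. Since
        \<open>u p\<close> and \<open>1 - a\<close> are nonzero, the eigenvector condition can be
        solved for \<open>\<kappa>\<close>.\<close>
      define p where "p = b / (1 - a)"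
      show ?thesis
      proof (rule fixed_point_not_supercyclic[OF assms(1,2) T])
        show "\<psi> p = p" using a by (simp add: ab p_def field_simps)
        show "deriv u p = deriv u p / (u p * (1 - a)) * u p * (1 - deriv \<psi> p)"
          using a False by (simp add: deriv field_simps)
        show "cmod (deriv \<psi> p) \<le> 1"
          unfolding deriv by (rule ab(2))
      qed
    qed
  qed
qed

end
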